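(* There exists a $C^3$ function $f:[0,1]\to(0,1)$ with isolated fixed points, $f\ge 1/2$, and having $1/2$ as unique stable fixed point, and there exists $l_1>0$, such that for every $l>0$, the generalized reinforced random walk associated to $f$ with law $\mathbb{P}_{0,w_0}$, where $w_0^x=(1/2,l)$ for all $x\in\mathbb{Z}$, is recurrent if $l\ge l_1$ and transient if $l<l_1$.
   Context: A fixed point $p$ of $f$ is stable if $f'(p)\le 1$. Generalized reinforced random walk started at $(0,w_0)$, $w_0=(\alpha_0^x,l_0^x)_{x\in\mathbb{Z}}$, associated to $f$: $X_0=0$; for $x\in\mathbb{Z}$, $n\ge0$ let $L_n^x=\sum_{k=0}^{n-1}1_{\{X_k=x\}}$ and $\tilde\alpha_n^x=\frac{1}{l_0^x+L_n^x}\big(\alpha_0^xl_0^x+\sum_{k=0}^{n-1}1_{\{X_k=x,X_{k+1}=x+1\}}\big)$; given the past, if $X_n=x$ then $X_{n+1}=x+1$ with probability $f(\tilde\alpha_n^x)$ and $X_{n+1}=x-1$ otherwise. Recurrent: every site visited infinitely often; transient: $X_n\to\pm\infty$. *)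

theory Defs
  imports "HOL-Probability.Probability"
begin

definition C3_on_unit :: "(real \<Rightarrow> real) \<Rightarrow> bool" where
  "C3_on_unit f \<longleftrightarrow> (\<exists>f1 f2 f3.
     (\<forall>x\<in>{0..1}. (f has_real_derivative f1 x) (at x within {0..1})) \<and>
     (\<forall>x\<in>{0..1}. (f1 has_real_derivative f2 x) (at x within {0..1})) \<and>
     (\<forall>x\<in>{0..1}. (f2 has_real_derivative f3 x) (at x within {0..1})) \<and>
     continuous_on {0..1} f3)"

definition is_fixed_point :: "(real \<Rightarrow> real) \<Rightarrow> real \<Rightarrow> bool" where
  "is_fixed_point f p \<longleftrightarrow> p \<in> {0..1} \<and> f p = p"

definition isolated_fixed_points :: "(real \<Rightarrow> real) \<Rightarrow> bool" where
  "isolated_fixed_points f \<longleftrightarrow>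
     (\<forall>p. is_fixed_point f p \<longrightarrow>
        (\<exists>e>0. \<forall>q. is_fixed_point f q \<and> \<bar>q - p\<bar> < e \<longrightarrow> q = p))"

definition stable_fixed_point :: "(real \<Rightarrow> real) \<Rightarrow> real \<Rightarrow> bool" where
  "stable_fixed_point f p \<longleftrightarrow> is_fixed_point f p \<and> deriv f p \<le> 1"

definition alpha_tilde :: "(int \<Rightarrow> real) \<Rightarrow> (int \<Rightarrow> real) \<Rightarrow> (nat \<Rightarrow> int) \<Rightarrow> nat \<Rightarrow> int \<Rightarrow> real" where
  "alpha_tilde \<alpha>0 l0 X n x =
     (\<alpha>0 x * l0 x + real (card {k. k < n \<and> X k = x \<and> X (Suc k) = x + 1}))
       / (l0 x + real (card {k. k < n \<and> X k = x}))"

text \<open>Canonical construction from i.i.d. uniform variables \<open>\<omega> n\<close>: at time n,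
  step right iff \<open>\<omega> n < f (\<tilde>\<alpha>_n^{X_n})\<close>. \<open>walk_hist \<dots> n\<close> holds the correct
  values of \<open>X_0, \<dots>, X_n\<close>.\<close>
fun walk_hist :: "(real \<Rightarrow> real) \<Rightarrow> (int \<Rightarrow> real) \<Rightarrow> (int \<Rightarrow> real) \<Rightarrow> (nat \<Rightarrow> real)
                    \<Rightarrow> nat \<Rightarrow> (nat \<Rightarrow> int)" where
  "walk_hist f \<alpha>0 l0 \<omega> 0 = (\<lambda>k. 0)"
| "walk_hist f \<alpha>0 l0 \<omega> (Suc n) =
     (let X = walk_hist f \<alpha>0 l0 \<omega> n in
        X(Suc n := X n + (if \<omega> n < f (alpha_tilde \<alpha>0 l0 X n (X n)) then 1 else -1)))"

definition grrw :: "(real \<Rightarrow> real) \<Rightarrow> (int \<Rightarrow> real) \<Rightarrow> (int \<Rightarrow> real) \<Rightarrow> (nat \<Rightarrow> real) \<Rightarrow> nat \<Rightarrow> int" where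
  "grrw f \<alpha>0 l0 \<omega> n = walk_hist f \<alpha>0 l0 \<omega> n n"

definition unif_seq :: "(nat \<Rightarrow> real) measure" where
  "unif_seq = PiM UNIV (\<lambda>_. uniform_measure lborel {0..1})"

definition recurrent :: "(nat \<Rightarrow> int) \<Rightarrow> bool" where
  "recurrent X \<longleftrightarrow> (\<forall>x::int. infinite {n. X n = x})"

definition transient :: "(nat \<Rightarrow> int) \<Rightarrow> bool" where
  "transient X \<longleftrightarrow> filterlim X at_top sequentially \<or> filterlim X at_bot sequentially"

end

theory Submission
  imports Defs
begin

text \<open>
  Give every site its own independent stack of arrows, distributed as the successive choices of the
  urn at that site; the walk reads these stacks. Let \<open>\<delta>\<close> be the expected total drift
  \<open>\<Sum> (2 f(\<alpha>) - 1)\<close> stored in one stack. Since \<open>f \<ge> 1/2\<close>, every positive site is reached, and the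
  numbers of left steps from the sites \<open>k - 1, \<dots>, 0\<close> before the first visit to \<open>k\<close> form a Markov chain
  on the naturals; the walk is recurrent iff this chain tends to infinity as \<open>k\<close> grows.

  If \<open>\<delta> > 1\<close> and the chain tended to infinity, all drift would eventually be used up at each site,
  whereas optional stopping shows that on average at most one unit per site is used; so the walk is
  transient, by a zero-one law. Conversely let \<open>p\<^sub>k\<close> be the probability of hitting \<open>k\<close> before \<open>-1\<close>, and
  \<open>e\<^sub>m\<close> the expected drift used at a fresh site before the walk gets \<open>m\<close> further. Optional stopping on
  \<open>[0, k)\<close> gives \<open>(k + 1) p\<^sub>k \<le> 1 + \<Sum> p\<^sub>x e\<^bsub>k - x\<^esub>\<close>. If \<open>p\<^sub>k\<close> had a positive limit, a fixed fraction of
  the drift would never be used, so \<open>e\<^sub>m \<le> \<delta> - \<epsilon>\<close>, which for \<open>\<delta> \<le> 1\<close> contradicts this inequality.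

  For \<open>f\<close> take a nondecreasing function equal to \<open>1/2\<close> on \<open>[0, 9/10]\<close> with \<open>f 1 = 4/5\<close>. A coupling shows
  that \<open>\<delta>\<close> is nonincreasing in \<open>l\<close>; it is lower semicontinuous, larger than \<open>1\<close> for small \<open>l\<close> and, by a
  Chernoff bound, at most \<open>1\<close> for large \<open>l\<close>. So \<open>\<delta> \<le> 1\<close> holds exactly on some \<open>[l\<^sub>1, \<infinity>)\<close>.
\<close>

section \<open>Predictable boolean sequences\<close>

text \<open>Fubini after splitting off coordinate \<open>i\<close>. On the right the split adds an
  integral over the overwritten coordinate, which has mass 1. This is how independence enters, both
  for the uniform variables and for the stacks.\<close>

lemma nn_integral_PiM_resample:
  fixes N :: "'a measure" and i :: 'i
  assumes N: "prob_space N" and \<Psi>[measurable]: "\<Psi> \<in> borel_measurable (PiM UNIV (\<lambda>_. N))"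
  shows "(\<integral>\<^sup>+s. \<Psi> s \<partial>PiM UNIV (\<lambda>_. N)) = (\<integral>\<^sup>+s. (\<integral>\<^sup>+t. \<Psi> (s(i := t)) \<partial>N) \<partial>PiM UNIV (\<lambda>_. N))"
proof -
  let ?I = "UNIV - {i}" and ?M = "\<lambda>_::'i. N"
  let ?P = "PiM UNIV ?M" and ?Q = "PiM ?I ?M"
  interpret N: prob_space N by fact
  interpret Q: prob_space ?Q by (rule prob_space_PiM) (rule N)
  interpret PQ: pair_sigma_finite N ?Q ..
  have eq: "distr (N \<Otimes>\<^sub>M ?Q) ?P (\<lambda>(x, X). X(i := x)) = ?P"
    using distr_pair_PiM_eq_PiM[of ?I ?M i] N by (simp add: insert_UNIV)
  have upd[measurable]: "(\<lambda>(x, X). X(i := x)) \<in> measurable (N \<Otimes>\<^sub>M ?Q) ?P"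
    unfolding split_beta by (rule measurable_fun_upd[where J="?I"]) auto
  have upd2[measurable]: "(\<lambda>(s, t). s(i := t)) \<in> measurable (?P \<Otimes>\<^sub>M N) ?P"
    unfolding split_beta by (rule measurable_fun_upd[where J="UNIV"]) auto
  have split: "(\<integral>\<^sup>+s. f s \<partial>?P) = (\<integral>\<^sup>+X. (\<integral>\<^sup>+x. f (X(i := x)) \<partial>N) \<partial>?Q)"
    if [measurable]: "f \<in> borel_measurable ?P" for f
  proof -
    have "(\<integral>\<^sup>+s. f s \<partial>?P) = (\<integral>\<^sup>+s. f s \<partial>distr (N \<Otimes>\<^sub>M ?Q) ?P (\<lambda>(x, X). X(i := x)))"
      by (simp only: eq)
    also have "\<dots> = (\<integral>\<^sup>+z. f ((snd z)(i := fst z)) \<partial>(N \<Otimes>\<^sub>M ?Q))"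
      by (subst nn_integral_distr) (auto simp: split_beta)
    also have "\<dots> = (\<integral>\<^sup>+X. (\<integral>\<^sup>+x. f (X(i := x)) \<partial>N) \<partial>?Q)"
      using upd by (subst PQ.nn_integral_snd[symmetric]) (auto simp: split_beta)
    finally show ?thesis .
  qed
  have m: "(\<lambda>s. \<integral>\<^sup>+t. \<Psi> (s(i := t)) \<partial>N) \<in> borel_measurable ?P"
    by (rule N.borel_measurable_nn_integral) (use measurable_compose[OF upd2 \<Psi>] in \<open>simp add: split_beta\<close>)
  show ?thesis
    using N.emeasure_space_1 by (subst split[OF m], subst split[OF \<Psi>]) simp
qed

text \<open>Finite histories are lists with the most recent entry first; \<open>True\<close> is a step to the right.\<close>
fun hist :: "(bool list \<Rightarrow> real) \<Rightarrow> (nat \<Rightarrow> real) \<Rightarrow> nat \<Rightarrow> bool list" where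
  "hist G u 0 = []"
| "hist G u (Suc n) = (u n < G (hist G u n)) # hist G u n"

fun pre :: "(nat \<Rightarrow> bool) \<Rightarrow> nat \<Rightarrow> bool list" where
  "pre b 0 = []"
| "pre b (Suc n) = b n # pre b n"

text \<open>The probability of a finite history: the product of the conditional probabilities of its
  entries.\<close>

fun wt :: "(bool list \<Rightarrow> real) \<Rightarrow> bool list \<Rightarrow> real" where
  "wt G [] = 1"
| "wt G (c # h) = wt G h * (if c then G h else 1 - G h)"

definition bool_seq :: "(nat \<Rightarrow> bool) measure" where
  "bool_seq = PiM UNIV (\<lambda>_. count_space UNIV)"

text \<open>The law of choices with \<open>G\<close> as conditional probability of a right step. It
  uses the same uniform variables and thresholds as \<open>walk_hist\<close>, so that the two
  constructions can later be compared pathwise.\<close>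

definition law :: "(bool list \<Rightarrow> real) \<Rightarrow> (nat \<Rightarrow> bool) measure" where
  "law G = distr unif_seq bool_seq (\<lambda>u n. u n < G (hist G u n))"

lemma length_pre [simp]: "length (pre b n) = n"
  by (induction n) auto

lemma length_hist [simp]: "length (hist G u n) = n"
  by (induction n) auto

lemma pre_hist: "pre (\<lambda>n. u n < G (hist G u n)) n = hist G u n"
  by (induction n) auto

lemma prob_space_unif01: "prob_space (uniform_measure lborel {0..1::real})"
  by (rule prob_space_uniform_measure) auto

lemma space_unif_seq [simp]: "space unif_seq = UNIV"
  by (auto simp: unif_seq_def space_PiM)

lemma prob_space_unif_seq: "prob_space unif_seq"
  unfolding unif_seq_def by (intro prob_space_PiM prob_space_unif01)

lemma unif_seq_component [measurable]: "(\<lambda>u. u n) \<in> borel_measurable unif_seq"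
proof -
  have "(\<lambda>u. u n) \<in> measurable unif_seq (uniform_measure lborel {0..1::real})"
    unfolding unif_seq_def by (rule measurable_component_singleton) simp
  then show ?thesis by (simp cong: measurable_cong_sets)
qed

lemma space_bool_seq [simp]: "space bool_seq = UNIV"
  by (auto simp: bool_seq_def space_PiM)

lemma bool_seq_component [measurable]: "(\<lambda>b. b n) \<in> measurable bool_seq (count_space UNIV)"
  unfolding bool_seq_def by (rule measurable_component_singleton) simp

lemma measurable_hist [measurable]: "(\<lambda>u. hist G u n) \<in> measurable unif_seq (count_space UNIV)"
proof (induction n)
  case (Suc n)
  have "(\<lambda>u. (u n < G h) # h) \<in> measurable unif_seq (count_space UNIV)" for h
    by measurable
  from measurable_compose_countable[OF this Suc] show ?case by simp
qed simp

lemma measurable_pre [measurable]: "(\<lambda>b. pre b n) \<in> measurable bool_seq (count_space UNIV)"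
proof (induction n)
  case (Suc n)
  have "(\<lambda>b. b n # h) \<in> measurable bool_seq (count_space UNIV)" for h
    by measurable
  from measurable_compose_countable[OF this Suc] show ?case by simp
qed simp

lemma measurable_arrows [measurable]: "(\<lambda>u n. u n < G (hist G u n)) \<in> measurable unif_seq bool_seq"
  unfolding bool_seq_def
proof (rule measurable_PiM_single')
  fix n show "(\<lambda>u. u n < G (hist G u n)) \<in> measurable unif_seq (count_space UNIV)"
  proof -
    have "(\<lambda>u. u n < G h) \<in> measurable unif_seq (count_space UNIV)" for h
      by measurable
    from measurable_compose_countable[OF this measurable_hist] show ?thesis .
  qed
qed auto

lemma sets_law [simp, measurable_cong]: "sets (law G) = sets bool_seq"
  by (simp add: law_def)

lemma space_law [simp]: "space (law G) = UNIV"
  by (simp add: law_def)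

lemma prob_space_law: "prob_space (law G)"
  unfolding law_def by (intro prob_space.prob_space_distr prob_space_unif_seq measurable_arrows)

lemma emeasure_unif01_less:
  assumes "0 \<le> g" "g \<le> 1"
  shows "emeasure (uniform_measure lborel {0..1::real}) {t. t < g} = ennreal g"
proof -
  have "{0..1} \<inter> {t. t < g} = {0..<g}" using assms by auto
  then show ?thesis using assms by (subst emeasure_uniform_measure) (simp_all add: divide_ennreal_def)
qed

lemma emeasure_unif01_ge:
  assumes "0 \<le> g" "g \<le> 1"
  shows "emeasure (uniform_measure lborel {0..1::real}) {t. \<not> t < g} = ennreal (1 - g)"
proof -
  have "{0..1} \<inter> {t. \<not> t < g} = {g..1}" using assms by auto
  then show ?thesis using assms by (subst emeasure_uniform_measure) (simp_all add: divide_ennreal_def)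
qed

lemma hist_upd: "m \<le> n \<Longrightarrow> hist G (u(n := t)) m = hist G u m"
  by (induction m) auto

lemma wt_nonneg: "(\<And>h. 0 \<le> G h) \<Longrightarrow> (\<And>h. G h \<le> 1) \<Longrightarrow> 0 \<le> wt G h"
  by (induction h) auto

text \<open>Resample \<open>u n\<close>: the history of length \<open>n\<close> does not see it, so
  the newest entry contributes the factor \<open>G h'\<close> or \<open>1 - G h'\<close>.\<close>

lemma emeasure_hist:
  assumes G: "\<And>h. 0 \<le> G h" "\<And>h. G h \<le> 1"
  shows "length h = n \<Longrightarrow> emeasure unif_seq {u. hist G u n = h} = ennreal (wt G h)"
proof (induction n arbitrary: h)
  case 0
  then show ?case using prob_space.emeasure_space_1[OF prob_space_unif_seq] by simp
next
  case (Suc n)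
  then obtain c h' where h: "h = c # h'" and l: "length h' = n" by (cases h) auto
  let ?U = "uniform_measure lborel {0..1::real}"
  let ?\<Psi> = "\<lambda>u. indicator {u. hist G u (Suc n) = h} u :: ennreal"
  have [measurable]: "{u. hist G u m = h} \<in> sets unif_seq" for m h
    using measurable_sets[OF measurable_hist, of "{h}" G m] by (simp add: vimage_def)
  have "emeasure unif_seq {u. hist G u (Suc n) = h} = (\<integral>\<^sup>+u. ?\<Psi> u \<partial>unif_seq)"
    by (simp del: hist.simps)
  also have "\<dots> = (\<integral>\<^sup>+u. (\<integral>\<^sup>+t. ?\<Psi> (u(n := t)) \<partial>?U) \<partial>unif_seq)"
    unfolding unif_seq_def
    by (rule nn_integral_PiM_resample[OF prob_space_unif01], fold unif_seq_def) measurable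
  also have "\<dots> = (\<integral>\<^sup>+u. (\<integral>\<^sup>+t. indicator {u. hist G u n = h'} u * indicator {t. (t < G h') = c} t \<partial>?U) \<partial>unif_seq)"
    by (intro nn_integral_cong) (auto simp: h hist_upd split: split_indicator)
  also have "\<dots> = (\<integral>\<^sup>+u. indicator {u. hist G u n = h'} u * emeasure ?U {t. (t < G h') = c} \<partial>unif_seq)"
    by (intro nn_integral_cong, subst nn_integral_cmult) auto
  also have "\<dots> = emeasure unif_seq {u. hist G u n = h'} * emeasure ?U {t. (t < G h') = c}"
    by (subst nn_integral_multc) auto
  also have "\<dots> = ennreal (wt G h)"
    using G emeasure_unif01_less[of "G h'"] emeasure_unif01_ge[of "G h'"]
    by (cases c) (simp_all add: h Suc.IH[OF l] ennreal_mult' ennreal_mult'')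
  finally show ?case .
qed

lemma sets_pre [measurable]: "{b. P (pre b n)} \<in> sets bool_seq"
  using measurable_sets[OF measurable_pre, of "Collect P" n] by (simp add: vimage_def)

lemma emeasure_law_pre:
  assumes "\<And>h. 0 \<le> G h" "\<And>h. G h \<le> 1" "length h = n"
  shows "emeasure (law G) {b. pre b n = h} = ennreal (wt G h)"
proof -
  have "emeasure (law G) {b. pre b n = h} = emeasure unif_seq {u. hist G u n = h}"
    unfolding law_def
    by (subst emeasure_distr) (auto simp: sets_pre[of "\<lambda>x. x = h"] vimage_def pre_hist intro!: arg_cong[where f="emeasure unif_seq"])
  then show ?thesis using emeasure_hist[OF assms] by simp
qed

section \<open>Expectations over finitely many choices, drift and optional stopping\<close>

lemma finite_length_eq [simp]: "finite {h::bool list. length h = n}"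
  using finite_lists_length_eq[of "UNIV::bool set" n] by simp

lemma nn_integral_finite_range:
  fixes f :: "'b \<Rightarrow> ennreal"
  assumes [measurable]: "Y \<in> measurable M (count_space UNIV)" and A: "finite A" "\<And>a. a \<in> space M \<Longrightarrow> Y a \<in> A"
  shows "(\<integral>\<^sup>+a. f (Y a) \<partial>M) = (\<Sum>h\<in>A. f h * emeasure M {a\<in>space M. Y a = h})"
proof -
  have [measurable]: "{a\<in>space M. Y a = h} \<in> sets M" for h by measurable
  have "(\<integral>\<^sup>+a. f (Y a) \<partial>M) = (\<integral>\<^sup>+a. (\<Sum>h\<in>A. f h * indicator {a\<in>space M. Y a = h} a) \<partial>M)"
  proof (rule nn_integral_cong)
    fix a assume a: "a \<in> space M"
    have "(\<Sum>h\<in>A. f h * indicator {a\<in>space M. Y a = h} a) = (\<Sum>h\<in>A. if Y a = h then f h else 0)"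
      using a by (intro sum.cong) auto
    also have "\<dots> = f (Y a)" using A a by simp
    finally show "f (Y a) = (\<Sum>h\<in>A. f h * indicator {a\<in>space M. Y a = h} a)" by simp
  qed
  also have "\<dots> = (\<Sum>h\<in>A. f h * emeasure M {a\<in>space M. Y a = h})"
    by (subst nn_integral_sum) (auto intro!: sum.cong nn_integral_cmult_indicator)
  finally show ?thesis .
qed

text \<open>A finite sum in place of an integral, so that statements about conditional means become
  inductions on \<open>n\<close>; the next lemma connects it with \<open>law G\<close>.\<close>

definition expect :: "(bool list \<Rightarrow> real) \<Rightarrow> nat \<Rightarrow> (bool list \<Rightarrow> real) \<Rightarrow> real" where
  "expect G n \<phi> = (\<Sum>h | length h = n. wt G h * \<phi> h)"

lemma nn_integral_law_pre:
  assumes G: "\<And>h. 0 \<le> G h" "\<And>h. G h \<le> 1" and \<phi>: "\<And>h. 0 \<le> \<phi> h"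
  shows "(\<integral>\<^sup>+b. ennreal (\<phi> (pre b n)) \<partial>law G) = ennreal (expect G n \<phi>)"
proof -
  have "(\<integral>\<^sup>+b. ennreal (\<phi> (pre b n)) \<partial>law G)
      = (\<Sum>h | length h = n. ennreal (\<phi> h) * emeasure (law G) {a\<in>space (law G). pre a n = h})"
    by (rule nn_integral_finite_range) auto
  also have "\<dots> = (\<Sum>h | length h = n. ennreal (wt G h * \<phi> h))"
    using G \<phi> by (intro sum.cong) (auto simp: emeasure_law_pre ennreal_mult' ennreal_mult'' wt_nonneg mult.commute)
  also have "\<dots> = ennreal (expect G n \<phi>)"
    using G \<phi> unfolding expect_def by (subst sum_ennreal) (auto intro!: mult_nonneg_nonneg wt_nonneg)
  finally show ?thesis .
qed

lemma lists_length_Suc: "{h::bool list. length h = Suc n} = (#) True ` {h. length h = n} \<union> (#) False ` {h. length h = n}"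
proof -
  have "h \<in> (#) True ` {h. length h = n} \<union> (#) False ` {h. length h = n}" if "length h = Suc n" for h
    using that by (cases h) (auto simp: image_iff)
  then show ?thesis by auto
qed

lemma expect_0 [simp]: "expect G 0 \<phi> = \<phi> []"
  by (simp add: expect_def)

text \<open>The tower property: the newest choice is the head of the list and is averaged first,
  given the older ones.\<close>

lemma expect_Suc: "expect G (Suc n) \<phi> = expect G n (\<lambda>h. G h * \<phi> (True # h) + (1 - G h) * \<phi> (False # h))"
  unfolding expect_def lists_length_Suc
  by (subst sum.union_disjoint) (auto simp: sum.reindex sum.distrib[symmetric] algebra_simps intro!: sum.cong)

lemma expect_const [simp]: "expect G n (\<lambda>_. c) = c"
  by (induction n) (simp_all add: expect_Suc algebra_simps)

lemma expect_add: "expect G n (\<lambda>h. \<phi> h + \<psi> h) = expect G n \<phi> + expect G n \<psi>"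
  by (simp add: expect_def algebra_simps sum.distrib)

lemma expect_diff: "expect G n (\<lambda>h. \<phi> h - \<psi> h) = expect G n \<phi> - expect G n \<psi>"
  by (simp add: expect_def algebra_simps sum_subtractf)

lemma expect_cmult: "expect G n (\<lambda>h. c * \<phi> h) = c * expect G n \<phi>"
  by (simp add: expect_def algebra_simps sum_distrib_left)

lemma expect_mono:
  assumes "\<And>h. 0 \<le> G h" "\<And>h. G h \<le> 1" "\<And>h. length h = n \<Longrightarrow> \<phi> h \<le> \<psi> h"
  shows "expect G n \<phi> \<le> expect G n \<psi>"
  unfolding expect_def using assms by (intro sum_mono mult_left_mono wt_nonneg) auto

fun drift :: "(bool list \<Rightarrow> real) \<Rightarrow> bool list \<Rightarrow> real" where
  "drift G [] = 0"
| "drift G (c # h) = drift G h + (2 * G h - 1)"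

text \<open>The history frozen at the first moment at which \<open>C\<close> fails. The older part
  is treated first, so once \<open>C\<close> has failed no later entry is added.\<close>

fun stp :: "(bool list \<Rightarrow> bool) \<Rightarrow> bool list \<Rightarrow> bool list" where
  "stp C [] = []"
| "stp C (c # h) = (if C (stp C h) then c # stp C h else stp C h)"

lemma stp_eq: "C (stp C h) \<Longrightarrow> stp C h = h"
  by (induction h) (auto split: if_splits)

text \<open>A single choice has conditional mean \<open>G h - (1 - G h) = 2 * G h - 1\<close>, which
  is exactly the increment of \<open>drift\<close>. So right steps minus left steps minus drift is a
  martingale, and freezing it preserves its mean.\<close>

lemma optional_stopping:
  "expect G n (\<lambda>h. real (count_list (stp C h) True) - real (count_list (stp C h) False) - drift G (stp C h)) = 0"
  (is "expect G n ?\<phi> = 0")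
proof (induction n)
  case (Suc n)
  have "G h * ?\<phi> (True # h) + (1 - G h) * ?\<phi> (False # h) = ?\<phi> h" for h
  proof (cases "C (stp C h)")
    case True
    then show ?thesis using stp_eq[of C h] by (simp add: algebra_simps)
  qed (simp add: algebra_simps)
  then show ?case by (simp add: expect_Suc Suc)
qed simp

text \<open>A run of \<open>j\<close> further entries \<open>c\<close> after time \<open>n\<close>
  has probability at most \<open>q ^ j\<close>, whatever happened before, so a constant tail is a
  null event.\<close>

lemma AE_not_eventually_const:
  assumes G: "\<And>h. 0 \<le> G h" "\<And>h. G h \<le> 1" and q: "q < 1"
    and c: "\<And>h. (if c then G h else 1 - G h) \<le> q"
  shows "AE b in law G. \<forall>n. \<exists>m\<ge>n. b m \<noteq> c"
proof -
  interpret prob_space "law G" by (rule prob_space_law)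
  have q0: "0 \<le> q" using c[of "[]"] G[of "[]"] by (auto split: if_splits)
  define run where "run j h = (if take j h = replicate j c then 1 else 0 :: real)" for j h
  have run_Suc: "run (Suc j) (x # h) = (if x = c then run j h else 0)" for j x h
    by (simp add: run_def)
  have run0: "0 \<le> run j h" for j h by (simp add: run_def)
  have le: "expect G (n + j) (run j) \<le> q ^ j" for n j
  proof (induction j)
    case 0
    then show ?case by (simp add: run_def)
  next
    case (Suc j)
    have "expect G (n + Suc j) (run (Suc j)) \<le> expect G (n + j) (\<lambda>h. q * run j h)"
      unfolding add_Suc_right expect_Suc
      using c run0 by (intro expect_mono G) (auto simp: run_Suc intro!: mult_right_mono)
    also have "\<dots> \<le> q * q ^ j" using Suc q0 by (simp add: expect_cmult mult_left_mono)
    finally show ?case by simp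
  qed
  have take_pre: "take j (pre b (n + j)) = replicate j c" if "\<forall>m\<ge>n. b m = c" for b n j
    using that by (induction j) auto
  have "AE b in law G. \<exists>m\<ge>n. b m \<noteq> c" for n
  proof -
    have [measurable]: "{b. \<forall>m\<ge>n. b m = c} \<in> sets bool_seq"
    proof -
      have "{b \<in> space bool_seq. \<forall>m\<ge>n. b m = c} \<in> sets bool_seq" by measurable
      then show ?thesis by simp
    qed
    have "emeasure (law G) {b. \<forall>m\<ge>n. b m = c} \<le> ennreal (q ^ j)" for j
    proof -
      have "emeasure (law G) {b. \<forall>m\<ge>n. b m = c} = (\<integral>\<^sup>+b. indicator {b. \<forall>m\<ge>n. b m = c} b \<partial>law G)"
        by simp
      also have "\<dots> \<le> (\<integral>\<^sup>+b. ennreal (run j (pre b (n + j))) \<partial>law G)"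
        by (intro nn_integral_mono) (auto simp: run_def take_pre split: split_indicator)
      also have "\<dots> \<le> ennreal (q ^ j)"
        using le[of n j] by (subst nn_integral_law_pre) (auto intro: G run0 ennreal_leI)
      finally show ?thesis .
    qed
    moreover have "(\<lambda>j. ennreal (q ^ j)) \<longlonglongrightarrow> ennreal 0"
      using q q0 by (intro tendsto_ennrealI LIMSEQ_realpow_zero) auto
    ultimately have "emeasure (law G) {b. \<forall>m\<ge>n. b m = c} \<le> ennreal 0"
      by (intro LIMSEQ_le_const) auto
    then show ?thesis
      by (intro AE_I[where N="{b. \<forall>m\<ge>n. b m = c}"]) auto
  qed
  then show ?thesis by (simp add: AE_all_countable)
qed

section \<open>The walk read off a family of arrow stacks\<close>

fun pos :: "bool list \<Rightarrow> int" where
  "pos [] = 0"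
| "pos (c # h) = pos h + (if c then 1 else -1)"

text \<open>The choices made on leaving \<open>x\<close>, newest first: the part of the stack at
  \<open>x\<close> that has already been read.\<close>

fun site :: "int \<Rightarrow> bool list \<Rightarrow> bool list" where
  "site x [] = []"
| "site x (c # h) = (if pos h = x then c # site x h else site x h)"

fun walk :: "(int \<Rightarrow> nat \<Rightarrow> bool) \<Rightarrow> nat \<Rightarrow> bool list" where
  "walk a 0 = []"
| "walk a (Suc n) = a (pos (walk a n)) (length (site (pos (walk a n)) (walk a n))) # walk a n"

definition steps :: "(int \<Rightarrow> nat \<Rightarrow> bool) \<Rightarrow> nat \<Rightarrow> bool" where
  "steps a n = a (pos (walk a n)) (length (site (pos (walk a n)) (walk a n)))"

lemma pre_steps: "pre (steps a) n = walk a n"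
  by (induction n) (auto simp: steps_def)

lemma length_walk [simp]: "length (walk a n) = n"
  by (induction n) auto

lemma site_walk: "site x (walk a n) = pre (a x) (length (site x (walk a n)))"
  by (induction n) auto

text \<open>No arrow is read twice, so prescribing the path amounts to prescribing an initial
  segment of every stack separately. This gives the product formula for independent stacks.\<close>

lemma walk_eq_iff: "walk a (length h) = h \<longleftrightarrow> (\<forall>x. pre (a x) (length (site x h)) = site x h)"
proof (induction h)
  case (Cons c h)
  have "walk a (length (c # h)) = c # h \<longleftrightarrow> walk a (length h) = h \<and> a (pos h) (length (site (pos h) h)) = c"
    by auto
  also have "\<dots> \<longleftrightarrow> (\<forall>x. pre (a x) (length (site x (c # h))) = site x (c # h))"
    unfolding Cons by auto
  finally show ?case .
qed simp

lemma pos_count: "pos h = int (count_list h True) - int (count_list h False)"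
  by (induction h) auto

text \<open>The net number of crossings of the edge between \<open>x\<close> and
  \<open>x + 1\<close> depends only on the sides of the edge on which the path starts and
  ends.\<close>

lemma flow:
  "int (count_list (site x h) True) - int (count_list (site (x + 1) h) False)
     = (if 0 \<le> x \<and> x < pos h then 1 else 0) - (if pos h \<le> x \<and> x < 0 then 1 else 0)"
  by (induction h) auto

text \<open>The head is the latest departure. After it a nearest-neighbour path cannot cross
  \<open>x\<close> again, so it stays on the side to which that step led.\<close>

lemma last_departure:
  "site x h \<noteq> [] \<Longrightarrow> x < pos h \<Longrightarrow> hd (site x h)"
  by (induction h) (auto split: if_splits)

text \<open>This and the next lemma translate the list encoding into the cardinalities that occur in
  \<open>alpha_tilde\<close>.\<close>

lemma length_site_pre: "length (site x (pre b n)) = card {m. m < n \<and> pos (pre b m) = x}"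
proof (induction n)
  case (Suc n)
  have "{m. m < Suc n \<and> pos (pre b m) = x} =
      (if pos (pre b n) = x then insert n {m. m < n \<and> pos (pre b m) = x} else {m. m < n \<and> pos (pre b m) = x})"
    by (auto simp: less_Suc_eq)
  then show ?case using Suc by simp
qed simp

lemma count_site_pre:
  "count_list (site x (pre b n)) True = card {m. m < n \<and> pos (pre b m) = x \<and> pos (pre b (Suc m)) = x + 1}"
proof (induction n)
  case (Suc n)
  have "{m. m < Suc n \<and> pos (pre b m) = x \<and> pos (pre b (Suc m)) = x + 1} =
      (if pos (pre b n) = x \<and> b n then insert n {m. m < n \<and> pos (pre b m) = x \<and> pos (pre b (Suc m)) = x + 1}
       else {m. m < n \<and> pos (pre b m) = x \<and> pos (pre b (Suc m)) = x + 1})"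
    by (auto simp: less_Suc_eq)
  then show ?case using Suc by simp
qed simp

lemma length_site_walk: "length (site x (walk a n)) = card {m. m < n \<and> pos (walk a m) = x}"
  using length_site_pre[of x "steps a" n] by (simp add: pre_steps)

lemma site_walk_mono: "m \<le> n \<Longrightarrow> length (site x (walk a m)) \<le> length (site x (walk a n))"
  by (induction n rule: dec_induct) auto

section \<open>Counting arrows in one stack\<close>

lemma count_pre_mono: "m \<le> n \<Longrightarrow> count_list (pre b m) c \<le> count_list (pre b n) c"
  by (induction n rule: dec_induct) auto

lemma count_pre_sum: "count_list (pre b n) True + count_list (pre b n) False = n"
  by (induction n) auto

definition recurring :: "bool \<Rightarrow> (nat \<Rightarrow> bool) \<Rightarrow> bool" where
  "recurring c b \<longleftrightarrow> (\<forall>n. \<exists>m\<ge>n. b m = c)"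

text \<open>The index \<open>m\<close> is that of occurrence number \<open>w + 1\<close> of
  \<open>c\<close>: the count stays constant up to the next occurrence.\<close>

lemma recurring_count:
  assumes "recurring c b"
  shows "\<exists>m. count_list (pre b m) c = w \<and> b m = c"
proof -
  have next_c: "\<exists>m. count_list (pre b m) c = count_list (pre b n) c \<and> b m = c" for n
  proof -
    define m where "m = (LEAST m. n \<le> m \<and> b m = c)"
    have m: "n \<le> m" "b m = c"
      using assms LeastI_ex[of "\<lambda>m. n \<le> m \<and> b m = c"] unfolding recurring_def m_def by auto
    have lt: "b k \<noteq> c" if "n \<le> k" "k < m" for k
      using not_less_Least[of k "\<lambda>m. n \<le> m \<and> b m = c"] that unfolding m_def by auto
    have "k \<le> m \<longrightarrow> count_list (pre b k) c = count_list (pre b n) c" if "n \<le> k" for k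
      using that by (induction k rule: dec_induct) (auto dest: lt)
    then show ?thesis using m by blast
  qed
  show ?thesis
  proof (induction w)
    case 0
    show ?case using next_c[of 0] by simp
  next
    case (Suc w)
    then obtain m where "count_list (pre b m) c = w" "b m = c" by auto
    then show ?case using next_c[of "Suc m"] by simp
  qed
qed

text \<open>The number of arrows of \<open>b\<close> up to and including the right arrow number \<open>w + 1\<close>; meaningful only if
  there are that many.\<close>
definition stop :: "(nat \<Rightarrow> bool) \<Rightarrow> nat \<Rightarrow> nat" where
  "stop b w = (LEAST m. count_list (pre b m) True = Suc w)"

definition lefts :: "(nat \<Rightarrow> bool) \<Rightarrow> nat \<Rightarrow> nat" where
  "lefts b w = count_list (pre b (stop b w)) False"

lemma stop_eqI:
  assumes "count_list (pre b m) True = w" "b m"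
  shows "stop b w = Suc m"
  unfolding stop_def
proof (rule Least_equality)
  show "count_list (pre b (Suc m)) True = Suc w" using assms by simp
  fix k assume "count_list (pre b k) True = Suc w"
  then show "Suc m \<le> k" using count_pre_mono[of k m b True] assms by (force simp: not_less_eq_eq)
qed

lemma count_stop:
  assumes "recurring True b"
  shows "count_list (pre b (stop b w)) True = Suc w"
proof -
  obtain m where "count_list (pre b m) True = w" "b m = True" using recurring_count[OF assms] by blast
  then show ?thesis using stop_eqI[of b m w] by simp
qed

lemma stop_mono: "recurring True b \<Longrightarrow> w \<le> w' \<Longrightarrow> stop b w \<le> stop b w'"
  using count_pre_mono[of "stop b w'" "stop b w" b True] count_stop[of b w] count_stop[of b w']
  by (cases "w = w'"; cases "stop b w \<le> stop b w'") auto

lemma stop_gt: "recurring True b \<Longrightarrow> w < stop b w"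
  using count_stop[of b w] count_pre_sum[of b "stop b w"] by linarith

lemma lefts_mono: "recurring True b \<Longrightarrow> w \<le> w' \<Longrightarrow> lefts b w \<le> lefts b w'"
  unfolding lefts_def by (intro count_pre_mono stop_mono)

lemma lefts_unbounded:
  assumes "recurring True b" "recurring False b"
  shows "\<exists>w. r \<le> lefts b w"
proof -
  obtain m where m: "count_list (pre b m) False = r" using recurring_count[OF assms(2)] by blast
  have "m \<le> stop b m" using stop_gt[OF assms(1), of m] by simp
  from count_pre_mono[OF this, of b False] show ?thesis using m unfolding lefts_def by blast
qed

text \<open>The number of steps from \<open>x\<close> to \<open>x - 1\<close> made before \<open>x + m\<close> is first visited, for a walk that has just
  arrived at \<open>x\<close> for the first time: each left step from \<open>x + 1\<close> forces one more right step from \<open>x\<close>.\<close>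
fun crossings :: "(int \<Rightarrow> nat \<Rightarrow> bool) \<Rightarrow> int \<Rightarrow> nat \<Rightarrow> nat" where
  "crossings a x 0 = 0"
| "crossings a x (Suc m) = lefts (a x) (crossings a (x + 1) m)"

lemma crossings_Suc_le:
  assumes "\<And>x. recurring True (a x)"
  shows "crossings a x m \<le> crossings a x (Suc m)"
proof (induction m arbitrary: x)
  case (Suc m)
  from lefts_mono[OF assms this[of "x + 1"]] show ?case by simp
qed simp

lemma crossings_mono:
  assumes "\<And>x. recurring True (a x)" "m \<le> m'"
  shows "crossings a x m \<le> crossings a x m'"
  using lift_Suc_mono_le[of "crossings a x", OF crossings_Suc_le[OF assms(1)] assms(2)] .

text \<open>Induction on \<open>j\<close>, from \<open>k\<close> leftwards. At the first visit to
  \<open>k\<close> no step from \<open>k\<close> has been made. Each left step from a site must be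
  matched by a right step from its left neighbour, with one extra right step because the walk ends
  further right.\<close>

lemma first_hit:
  assumes rec: "\<And>x. recurring True (a x)"
    and k: "pos (walk a n) = int k" "site (int k) (walk a n) = []"
  shows "j \<le> k \<Longrightarrow> count_list (site (int k - int j) (walk a n)) False = crossings a (int k - int j) j"
    and "j < k \<Longrightarrow> length (site (int k - int (Suc j)) (walk a n)) = stop (a (int k - int (Suc j))) (crossings a (int k - int j) j)"
proof -
  let ?h = "walk a n"
  have step: "length (site (int k - int (Suc j)) ?h) = stop (a (int k - int (Suc j))) (crossings a (int k - int j) j)"
    if "j < k" "count_list (site (int k - int j) ?h) False = crossings a (int k - int j) j" for j
  proof -
    let ?x = "int k - int (Suc j)"
    \<comment> \<open>The successor is the net crossing of the edge: \<open>0 \<le> ?x < k\<close>,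
      as \<open>j < k\<close>.\<close>
    have c: "count_list (site ?x ?h) True = Suc (crossings a (int k - int j) j)"
      using flow[of ?x ?h] that k(1) by (simp add: algebra_simps)
    obtain m where m: "length (site ?x ?h) = Suc m" using c by (cases "length (site ?x ?h)") auto
    have "site ?x ?h = pre (a ?x) (Suc m)" using site_walk[of ?x a n] m by simp
    \<comment> \<open>The segment read at \<open>?x\<close> ends with a right arrow, so it has the
      least length containing that many right arrows, which is \<open>stop\<close>.\<close>
    moreover from this have "a ?x m" using last_departure[of ?x ?h] k(1) by simp
    ultimately show ?thesis using c m stop_eqI[of "a ?x" m "crossings a (int k - int j) j"] by simp
  qed
  show count: "count_list (site (int k - int j) ?h) False = crossings a (int k - int j) j" if "j \<le> k" for j
    using that
  proof (induction j)
    case 0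
    then show ?case using k by simp
  next
    case (Suc j)
    let ?x = "int k - int (Suc j)"
    have "length (site ?x ?h) = stop (a ?x) (crossings a (int k - int j) j)"
      using Suc by (intro step) auto
    then have "site ?x ?h = pre (a ?x) (stop (a ?x) (crossings a (int k - int j) j))"
      using site_walk[of ?x a n] by simp
    then show ?case by (simp add: lefts_def algebra_simps)
  qed
  show "length (site (int k - int (Suc j)) ?h) = stop (a (int k - int (Suc j))) (crossings a (int k - int j) j)"
    if "j < k" using that count[of j] by (intro step) auto
qed

lemma first_hit_exists:
  assumes "pos (walk a n) = x"
  shows "\<exists>m\<le>n. pos (walk a m) = x \<and> site x (walk a m) = []"
proof -
  define m where "m = (LEAST m. pos (walk a m) = x)"
  have "pos (walk a m) = x" "m \<le> n"
    using assms unfolding m_def by (auto intro: LeastI Least_le)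
  moreover have "{j. j < m \<and> pos (walk a j) = x} = {}"
    using not_less_Least[of _ "\<lambda>m. pos (walk a m) = x"] unfolding m_def by auto
  then have "length (site x (walk a m)) = 0" by (simp only: length_site_walk card.empty)
  ultimately show ?thesis by auto
qed

section \<open>Infinitely many visits, recurrence and transience along one path\<close>

definition visited_io :: "(int \<Rightarrow> nat \<Rightarrow> bool) \<Rightarrow> int \<Rightarrow> bool" where
  "visited_io a x \<longleftrightarrow> (\<forall>r. \<exists>n. r \<le> length (site x (walk a n)))"

lemma visited_io_iff: "visited_io a x \<longleftrightarrow> infinite {n. pos (walk a n) = x}"
proof
  assume v: "visited_io a x"
  show "infinite {n. pos (walk a n) = x}"
  proof
    assume fin: "finite {n. pos (walk a n) = x}"
    obtain n where "Suc (card {n. pos (walk a n) = x}) \<le> length (site x (walk a n))"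
      using v unfolding visited_io_def by blast
    also have "\<dots> \<le> card {n. pos (walk a n) = x}"
      unfolding length_site_walk by (intro card_mono fin) auto
    finally show False by simp
  qed
next
  assume inf: "infinite {n. pos (walk a n) = x}"
  show "visited_io a x" unfolding visited_io_def
  proof
    fix r
    obtain A where A: "finite A" "card A = r" "A \<subseteq> {n. pos (walk a n) = x}"
      using infinite_arbitrarily_large[OF inf] by blast
    define n where "n = Suc (Max (insert 0 A))"
    have "\<forall>m\<in>A. m < n" using A(1) by (auto simp: n_def less_Suc_eq_le)
    then have "card A \<le> card {m. m < n \<and> pos (walk a m) = x}"
      using A by (intro card_mono) auto
    then show "\<exists>n. r \<le> length (site x (walk a n))" using A by (auto simp: length_site_walk)
  qed
qed

lemma visited_io_count:
  assumes "visited_io a x" "recurring c (a x)"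
  shows "\<exists>n. r \<le> count_list (site x (walk a n)) c"
proof -
  obtain m where m: "count_list (pre (a x) m) c = r" using recurring_count[OF assms(2)] by blast
  obtain n where n: "m \<le> length (site x (walk a n))" using assms(1) unfolding visited_io_def by blast
  have "r \<le> count_list (pre (a x) (length (site x (walk a n)))) c"
    using count_pre_mono[OF n, of "a x" c] m by simp
  then show ?thesis using site_walk[of x a n] by metis
qed

text \<open>Infinitely many right steps are made from \<open>x\<close>, and by \<open>flow\<close>
  all but at most one of those made so far are compensated by left steps from
  \<open>x + 1\<close>.\<close>

lemma visited_io_right:
  assumes "visited_io a x" "recurring True (a x)"
  shows "visited_io a (x + 1)"
  unfolding visited_io_def
proof
  fix r
  obtain n where "Suc r \<le> count_list (site x (walk a n)) True" using visited_io_count[OF assms] by blast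
  then have "r \<le> count_list (site (x + 1) (walk a n)) False" using flow[of x "walk a n"] by (auto split: if_splits)
  also have "\<dots> \<le> length (site (x + 1) (walk a n))" by (rule count_le_length)
  finally show "\<exists>n. r \<le> length (site (x + 1) (walk a n))" by blast
qed

lemma visited_io_left:
  assumes "visited_io a x" "recurring False (a x)"
  shows "visited_io a (x - 1)"
  unfolding visited_io_def
proof
  fix r
  obtain n where "Suc r \<le> count_list (site x (walk a n)) False" using visited_io_count[OF assms] by blast
  then have "r \<le> count_list (site (x - 1) (walk a n)) True" using flow[of "x - 1" "walk a n"] by (auto split: if_splits)
  also have "\<dots> \<le> length (site (x - 1) (walk a n))" by (rule count_le_length)
  finally show "\<exists>n. r \<le> length (site (x - 1) (walk a n))" by blast
qed

lemma visited_io_all: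
  assumes v: "visited_io a x" and rec: "\<And>c x. recurring c (a x)"
  shows "visited_io a y"
proof (induction y rule: int_induct[where k=x])
  case base
  show ?case by (rule v)
next
  case (step1 i)
  then show ?case using visited_io_right rec by blast
next
  case (step2 i)
  then show ?case using visited_io_left rec by blast
qed

text \<open>Otherwise some site of \<open>A\<close> is visited infinitely often by the pigeonhole
  principle, and then so is every site, including those outside \<open>A\<close>.\<close>

lemma exits_finite:
  assumes rec: "\<And>c x. recurring c (a x)" and A: "finite A"
  shows "\<exists>n. pos (walk a n) \<notin> A"
proof (rule ccontr)
  assume "\<not> ?thesis"
  then have in_A: "pos (walk a n) \<in> A" for n by auto
  have "\<exists>x\<in>A. infinite {n. pos (walk a n) = x}"
  proof (rule ccontr)
    assume "\<not> ?thesis"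
    then have "finite (\<Union>x\<in>A. {n. pos (walk a n) = x})" using A by auto
    moreover have "(\<Union>x\<in>A. {n. pos (walk a n) = x}) = UNIV" using in_A by auto
    ultimately show False by simp
  qed
  then obtain x where x: "visited_io a x" by (auto simp: visited_io_iff)
  obtain y where y: "y \<notin> A" using A ex_new_if_finite[OF infinite_UNIV_int] by blast
  have "visited_io a y" using visited_io_all[OF x rec] .
  then have "{n. pos (walk a n) = y} \<noteq> {}" unfolding visited_io_iff using infinite_imp_nonempty by blast
  then show False using in_A y by auto
qed

text \<open>By \<open>first_hit\<close>, \<open>crossings a 0 k\<close> counts the left steps from
  \<open>0\<close> before the first visit to \<open>k\<close>. If these numbers are unbounded,
  \<open>0\<close> is visited infinitely often, and hence every site is.\<close>

lemma recurrent_if_crossings_unbounded: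
  assumes rec: "\<And>c x. recurring c (a x)" and hits: "\<And>k. \<exists>n. pos (walk a n) = int k"
    and unb: "\<And>r. \<exists>m. r \<le> crossings a 0 m"
  shows "recurrent (\<lambda>n. pos (walk a n))"
proof -
  have "visited_io a 0" unfolding visited_io_def
  proof
    fix r
    obtain k where k: "r \<le> crossings a 0 k" using unb by blast
    obtain n where n: "pos (walk a n) = int k" "site (int k) (walk a n) = []"
      using hits first_hit_exists by blast
    have "crossings a 0 k = count_list (site 0 (walk a n)) False"
      using first_hit(1)[OF rec n, of k] by simp
    also have "\<dots> \<le> length (site 0 (walk a n))" by (rule count_le_length)
    finally show "\<exists>n. r \<le> length (site 0 (walk a n))" using k order_trans by blast
  qed
  from visited_io_all[OF this rec] show ?thesis
    unfolding recurrent_def visited_io_iff by blast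
qed

text \<open>Every left step from \<open>0\<close> precedes the first visit to some far site, so
  there are at most \<open>r\<close> of them and no site is visited infinitely often. The walk then
  leaves every interval \<open>[0, N]\<close> for good, and by \<open>hits\<close> it does so to the
  right.\<close>

lemma transient_if_crossings_bounded:
  assumes rec: "\<And>c x. recurring c (a x)" and hits: "\<And>k. \<exists>n. pos (walk a n) = int k"
    and bdd: "\<And>m. crossings a 0 m \<le> r"
  shows "filterlim (\<lambda>n. pos (walk a n)) at_top sequentially"
proof -
  have le_r: "count_list (site 0 (walk a n)) False \<le> r" for n
  proof -
    obtain N where N: "pos (walk a N) = int n" "site (int n) (walk a N) = []"
      using hits first_hit_exists by blast
    have "\<bar>pos h\<bar> \<le> int (length h)" for h by (induction h) auto
    \<comment> \<open>Reaching \<open>n\<close> takes at least \<open>n\<close> steps, so all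
      departures before time \<open>n\<close> are counted at time \<open>N\<close>.\<close>
    from this[of "walk a N"] have "n \<le> N" using N(1) by simp
    then have "length (site 0 (walk a n)) \<le> length (site 0 (walk a N))" by (rule site_walk_mono)
    then have "count_list (site 0 (walk a n)) False \<le> count_list (site 0 (walk a N)) False"
      using count_pre_mono[of _ _ "a 0" False] site_walk[of 0 a n] site_walk[of 0 a N] by metis
    also have "\<dots> = crossings a 0 n" using first_hit(1)[OF rec N, of n] by simp
    finally show ?thesis using bdd[of n] by simp
  qed
  have not_io: "\<not> visited_io a x" for x
  proof
    assume "visited_io a x"
    from visited_io_count[OF visited_io_all[OF this rec] rec]
    obtain n where "Suc r \<le> count_list (site 0 (walk a n)) False"
      by blast
    then show False using le_r[of n] by simp
  qed
  show ?thesis unfolding filterlim_at_top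
  proof
    fix Z :: int
    \<comment> \<open>\<open>N \<ge> 1\<close> ensures that one step from beyond \<open>N\<close>
      cannot lead below \<open>0\<close>.\<close>
    define N where "N = nat (max Z 1)"
    have "finite (\<Union>x\<in>{0..int N}. {n. pos (walk a n) = x})"
      using not_io by (auto simp: visited_io_iff)
    then obtain m where m: "\<forall>n\<in>(\<Union>x\<in>{0..int N}. {n. pos (walk a n) = x}). n < m"
      using finite_nat_set_iff_bounded by blast
    have far: "pos (walk a n) < 0 \<or> int N < pos (walk a n)" if "m \<le> n" for n
    proof (rule ccontr)
      assume "\<not> ?thesis"
      then have "n \<in> (\<Union>x\<in>{0..int N}. {n. pos (walk a n) = x})" by auto
      with m have "n < m" by blast
      with that show False by simp
    qed
    \<comment> \<open>Reaching \<open>k\<close> takes at least \<open>m\<close> steps, so the walk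
      is beyond \<open>N\<close> at a time after its last visit to \<open>[0, N]\<close>.\<close>
    define k where "k = N + m + 1"
    obtain n0 where n0: "pos (walk a n0) = int k" using hits by blast
    have "\<bar>pos h\<bar> \<le> int (length h)" for h by (induction h) auto
    from this[of "walk a n0"] have "m \<le> n0" using n0 by (simp add: k_def)
    have "int N < pos (walk a n)" if "n0 \<le> n" for n
      using that
    proof (induction n rule: dec_induct)
      case base
      then show ?case using n0 by (simp add: k_def)
    next
      case (step n)
      then have "int N - 1 < pos (walk a (Suc n))" by auto
      moreover have "1 \<le> int N" by (simp add: N_def)
      ultimately show ?case using far[of "Suc n"] step \<open>m \<le> n0\<close> by auto
    qed
    moreover have "Z \<le> int N" by (auto simp: N_def max_def)
    ultimately show "\<forall>\<^sub>F n in sequentially. Z \<le> pos (walk a n)"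
      unfolding eventually_sequentially by (metis less_imp_le order_trans)
  qed
qed

section \<open>Independent stacks\<close>

lemma pre_nth: "i < n \<Longrightarrow> pre b n ! (n - Suc i) = b i"
proof (induction n)
  case (Suc n)
  then show ?case by (cases "i = n") (auto simp: nth_Cons' Suc_diff_Suc)
qed simp

text \<open>A cylinder over finitely many coordinates below \<open>n\<close> is a finite union of
  events fixing the first \<open>n\<close> entries.\<close>

lemma measure_eqI_bool_seq:
  assumes sets: "sets P = sets bool_seq" "sets Q = sets bool_seq" and fin: "finite_measure P"
    and eq: "\<And>h. emeasure P {b. pre b (length h) = h} = emeasure Q {b. pre b (length h) = h}"
  shows "P = Q"
proof (rule measure_eqI_PiM_infinite[where I=UNIV and M="\<lambda>_. count_space UNIV"])
  note [measurable_cong] = sets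
  have space: "space P = UNIV" "space Q = UNIV"
    using sets_eq_imp_space_eq[OF sets(1)] sets_eq_imp_space_eq[OF sets(2)] by auto
  fix A :: "nat \<Rightarrow> bool set" and J :: "nat set"
  assume "finite J"
  then obtain n where n: "J \<subseteq> {..<n}" by (meson finite_nat_iff_bounded)
  define H where "H = {h. \<forall>i\<in>J. h ! (n - Suc i) \<in> A i}"
  have E: "prod_emb UNIV (\<lambda>_. count_space UNIV) J (Pi\<^sub>E J A) = {b. pre b n \<in> H}"
  proof -
    have "pre b n ! (n - Suc i) = b i" if "i \<in> J" for b i using n that by (intro pre_nth) auto
    then show ?thesis by (simp add: prod_emb_def H_def PiE_iff vimage_def)
  qed
  have "emeasure R {b. pre b n \<in> H} = (\<Sum>h | length h = n. indicator H h * emeasure R {b. pre b n = h})"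
    if [measurable_cong]: "sets R = sets bool_seq" and "space R = UNIV" for R
  proof -
    have [measurable]: "{b. pre b n \<in> H} \<in> sets R" unfolding that(1) by (rule sets_pre)
    have "emeasure R {b. pre b n \<in> H} = (\<integral>\<^sup>+b. indicator {b. pre b n \<in> H} b \<partial>R)"
      by simp
    also have "\<dots> = (\<integral>\<^sup>+b. indicator H (pre b n) \<partial>R)"
      by (intro nn_integral_cong) (auto split: split_indicator)
    also have "\<dots> = (\<Sum>h | length h = n. indicator H h * emeasure R {b\<in>space R. pre b n = h})"
      by (rule nn_integral_finite_range) auto
    finally show ?thesis using that by simp
  qed
  from this[OF sets(1) space(1)] this[OF sets(2) space(2)]
  show "emeasure P (prod_emb UNIV (\<lambda>_. count_space UNIV) J (Pi\<^sub>E J A)) =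
      emeasure Q (prod_emb UNIV (\<lambda>_. count_space UNIV) J (Pi\<^sub>E J A))"
    unfolding E using eq by (auto intro!: sum.cong)
qed (use assms in \<open>auto simp: bool_seq_def\<close>)

section \<open>Law of the walk driven by independent stacks\<close>

lemma finite_sites: "finite {x. site x h \<noteq> []}"
proof (induction h)
  case (Cons c h)
  then show ?case by (rule finite_subset[rotated, OF finite.insertI[of _ "pos h"]]) auto
qed simp

text \<open>The conditional probability of a right step of the walk: only the past choices at the
  present site matter.\<close>

definition walk_predictor :: "(bool list \<Rightarrow> real) \<Rightarrow> bool list \<Rightarrow> real" where
  "walk_predictor G h = G (site (pos h) h)"

text \<open>The product along the path is regrouped by sites; \<open>A\<close> is any finite set
  containing all sites that have been left.\<close>

lemma wt_walk:
  "finite A \<Longrightarrow> (\<And>x. x \<notin> A \<Longrightarrow> site x h = []) \<Longrightarrow> wt (walk_predictor G) h = (\<Prod>x\<in>A. wt G (site x h))"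
proof (induction h)
  case (Cons c h)
  let ?x = "pos h"
  have x: "?x \<in> A" using Cons.prems(2)[of ?x] by auto
  have nil: "site x h = []" if "x \<notin> A" for x
    using Cons.prems(2)[OF that] by (simp split: if_splits)
  have "wt (walk_predictor G) h = (\<Prod>x\<in>A. wt G (site x h))"
    by (intro Cons.IH Cons.prems nil)
  also have "\<dots> = wt G (site ?x h) * (\<Prod>x\<in>A - {?x}. wt G (site x h))"
    using x Cons.prems by (intro prod.remove) auto
  finally have IH: "wt (walk_predictor G) h = \<dots>" .
  have "(\<Prod>x\<in>A. wt G (site x (c # h))) = wt G (site ?x (c # h)) * (\<Prod>x\<in>A - {?x}. wt G (site x (c # h)))"
    using x Cons.prems by (intro prod.remove) auto
  also have "(\<Prod>x\<in>A - {?x}. wt G (site x (c # h))) = (\<Prod>x\<in>A - {?x}. wt G (site x h))"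
    by (intro prod.cong) auto
  finally show ?case using IH by (simp add: walk_predictor_def[of G h])
qed simp

lemma drift_walk:
  "finite A \<Longrightarrow> (\<And>x. x \<notin> A \<Longrightarrow> site x h = []) \<Longrightarrow> drift (walk_predictor G) h = (\<Sum>x\<in>A. drift G (site x h))"
proof (induction h)
  case (Cons c h)
  let ?x = "pos h"
  have x: "?x \<in> A" using Cons.prems(2)[of ?x] by auto
  have nil: "site x h = []" if "x \<notin> A" for x
    using Cons.prems(2)[OF that] by (simp split: if_splits)
  have "drift (walk_predictor G) h = (\<Sum>x\<in>A. drift G (site x h))"
    by (intro Cons.IH Cons.prems nil)
  also have "\<dots> = drift G (site ?x h) + (\<Sum>x\<in>A - {?x}. drift G (site x h))"
    using x Cons.prems by (intro sum.remove) auto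
  finally have IH: "drift (walk_predictor G) h = \<dots>" .
  have "(\<Sum>x\<in>A. drift G (site x (c # h))) = drift G (site ?x (c # h)) + (\<Sum>x\<in>A - {?x}. drift G (site x (c # h)))"
    using x Cons.prems by (intro sum.remove) auto
  also have "(\<Sum>x\<in>A - {?x}. drift G (site x (c # h))) = (\<Sum>x\<in>A - {?x}. drift G (site x h))"
    by (intro sum.cong) auto
  finally show ?case using IH by (simp add: walk_predictor_def[of G h])
qed simp

definition env :: "(bool list \<Rightarrow> real) \<Rightarrow> (int \<Rightarrow> nat \<Rightarrow> bool) measure" where
  "env G = PiM UNIV (\<lambda>_. law G)"

lemma space_env [simp]: "space (env G) = UNIV"
  by (auto simp: env_def space_PiM)

lemma prob_space_env: "prob_space (env G)"
  unfolding env_def by (intro prob_space_PiM prob_space_law)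

lemma env_component [measurable]: "(\<lambda>a. a x) \<in> measurable (env G) bool_seq"
proof -
  have "(\<lambda>a. a x) \<in> measurable (env G) (law G)"
    unfolding env_def by (rule measurable_component_singleton) simp
  then show ?thesis by (simp cong: measurable_cong_sets)
qed

lemma measurable_walk [measurable]: "(\<lambda>a. walk a n) \<in> measurable (env G) (count_space UNIV)"
proof (induction n)
  case (Suc n)
  have "(\<lambda>a. a (pos h) (length (site (pos h) h)) # h) \<in> measurable (env G) (count_space UNIV)" for h
    by measurable
  from measurable_compose_countable[where f="\<lambda>h a. a (pos h) (length (site (pos h) h)) # h", OF this Suc]
  show ?case by simp
qed simp

lemma measurable_steps [measurable]: "steps \<in> measurable (env G) bool_seq"
  unfolding bool_seq_def
proof (rule measurable_PiM_single')
  fix n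
  have "(\<lambda>a. a (pos h) (length (site (pos h) h))) \<in> measurable (env G) (count_space UNIV)" for h
    by measurable
  from measurable_compose_countable[where f="\<lambda>h a. a (pos h) (length (site (pos h) h))", OF this measurable_walk]
  show "(\<lambda>a. steps a n) \<in> measurable (env G) (count_space UNIV)" by (simp add: steps_def)
qed auto

lemma measurable_stop [measurable]: "(\<lambda>b. stop b w) \<in> measurable bool_seq (count_space UNIV)"
  unfolding stop_def by measurable

lemma measurable_pre_stop [measurable]: "(\<lambda>b. pre b (stop b w)) \<in> measurable bool_seq (count_space UNIV)"
  by (rule measurable_compose_countable[OF measurable_pre measurable_stop])

lemma measurable_lefts [measurable]: "(\<lambda>b. lefts b w) \<in> measurable bool_seq (count_space UNIV)"
  unfolding lefts_def by measurable

lemma measurable_crossings [measurable]: "(\<lambda>a. crossings a x m) \<in> measurable (env G) (count_space UNIV)"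
proof (induction m arbitrary: x)
  case (Suc m)
  have "(\<lambda>a. lefts (a x) w) \<in> measurable (env G) (count_space UNIV)" for w
    by measurable
  from measurable_compose_countable[where f="\<lambda>w a. lefts (a x) w", OF this Suc] show ?case by simp
qed simp

text \<open>By \<open>walk_eq_iff\<close> the event is a cylinder over the visited sites, so its
  probability factorizes, and \<open>wt_walk\<close> reassembles the factors.\<close>

lemma emeasure_walk:
  assumes G: "\<And>h. 0 \<le> G h" "\<And>h. G h \<le> 1"
  shows "emeasure (env G) {a. walk a (length h) = h} = ennreal (wt (walk_predictor G) h)"
proof -
  let ?A = "{x. site x h \<noteq> []}"
  let ?B = "\<lambda>x. {b. pre b (length (site x h)) = site x h}"
  have "{a. walk a (length h) = h} = prod_emb UNIV (\<lambda>_. law G) ?A (Pi\<^sub>E ?A ?B)"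
    by (auto simp: walk_eq_iff prod_emb_def PiE_iff) force
  then have "emeasure (env G) {a. walk a (length h) = h} = (\<Prod>x\<in>?A. emeasure (law G) (?B x))"
    unfolding env_def using finite_sites[of h] sets_pre by (simp add: emeasure_PiM_emb prob_space_law)
  also have "\<dots> = (\<Prod>x\<in>?A. ennreal (wt G (site x h)))"
    using G by (intro prod.cong refl emeasure_law_pre) auto
  also have "\<dots> = ennreal (wt (walk_predictor G) h)"
    using G by (subst wt_walk[where A="?A"]) (auto simp: finite_sites prod_ennreal wt_nonneg)
  finally show ?thesis .
qed

lemma distr_steps:
  assumes G: "\<And>h. 0 \<le> G h" "\<And>h. G h \<le> 1"
  shows "distr (env G) bool_seq steps = law (walk_predictor G)"
proof (rule measure_eqI_bool_seq)
  interpret prob_space "env G" by (rule prob_space_env)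
  show "finite_measure (distr (env G) bool_seq steps)"
    by (intro prob_space.finite_measure prob_space_distr measurable_steps)
  fix h
  have "emeasure (distr (env G) bool_seq steps) {b. pre b (length h) = h} = emeasure (env G) {a. walk a (length h) = h}"
    by (subst emeasure_distr) (auto simp: pre_steps vimage_def sets_pre[of "\<lambda>x. x = h"])
  also have "\<dots> = emeasure (law (walk_predictor G)) {b. pre b (length h) = h}"
    using G by (subst emeasure_law_pre) (auto simp: emeasure_walk walk_predictor_def)
  finally show "emeasure (distr (env G) bool_seq steps) {b. pre b (length h) = h} =
      emeasure (law (walk_predictor G)) {b. pre b (length h) = h}" .
qed simp_all

text \<open>Carries almost sure statements from the walk read off independent stacks to the walk
  driven by uniform variables.\<close>

lemma AE_grrw_law:
  assumes G: "\<And>h. 0 \<le> G h" "\<And>h. G h \<le> 1" and P: "{b. P b} \<in> sets bool_seq"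
    and AE: "AE a in env G. P (steps a)"
  shows "AE u in unif_seq. P (\<lambda>n. u n < walk_predictor G (hist (walk_predictor G) u n))"
proof -
  have P': "{b \<in> space bool_seq. P b} \<in> sets bool_seq" using P by simp
  have "AE b in law (walk_predictor G). P b"
    unfolding distr_steps[OF G, symmetric] using AE by (simp add: AE_distr_iff[OF measurable_steps P'])
  then show ?thesis
    unfolding law_def by (simp add: AE_distr_iff[OF measurable_arrows P'])
qed

lemma nn_integral_walk:
  assumes G: "\<And>h. 0 \<le> G h" "\<And>h. G h \<le> 1" and \<phi>: "\<And>h. 0 \<le> \<phi> h"
  shows "(\<integral>\<^sup>+a. ennreal (\<phi> (walk a n)) \<partial>env G) = ennreal (expect (walk_predictor G) n \<phi>)"
proof -
  have [measurable]: "(\<lambda>b. ennreal (\<phi> (pre b n))) \<in> borel_measurable bool_seq"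
    by (rule measurable_compose[OF measurable_pre]) simp
  have "(\<integral>\<^sup>+a. ennreal (\<phi> (walk a n)) \<partial>env G) = (\<integral>\<^sup>+b. ennreal (\<phi> (pre b n)) \<partial>distr (env G) bool_seq steps)"
    by (subst nn_integral_distr) (auto simp: pre_steps)
  then show ?thesis using G \<phi> by (simp add: distr_steps nn_integral_law_pre walk_predictor_def)
qed

lemma sets_env: "Measurable.pred (env G) P \<Longrightarrow> {a. P a} \<in> sets (env G)"
  unfolding pred_def by simp

lemma pred_crossings: "Measurable.pred (env G) (\<lambda>a. P (crossings a x m))"
  by (rule measurable_compose[OF measurable_crossings]) simp

text \<open>With the next lemma: \<open>crossings a x m\<close> reads only the stacks at
  \<open>x, ..., x + m - 1\<close>. All independence statements below rest on this.\<close>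

lemma crossings_upd_left: "y < x \<Longrightarrow> crossings (a(y := t)) x m = crossings a x m"
  by (induction m arbitrary: x) auto

lemma crossings_upd_right: "x + int m \<le> y \<Longrightarrow> crossings (a(y := t)) x m = crossings a x m"
  by (induction m arbitrary: x) auto

section \<open>Recurrence criterion\<close>

locale site_law =
  fixes G :: "bool list \<Rightarrow> real" and q :: real
  assumes G_ge: "1 / 2 \<le> G h" and G_le: "G h \<le> q" and q_less: "q < 1"
    and excited: "\<exists>n. 1 / 2 < G (replicate (Suc n) True)"
begin

lemma G_nonneg: "0 \<le> G h" and G_le_1: "G h \<le> 1"
  using G_ge[of h] G_le[of h] q_less by auto

sublocale L: prob_space "law G" by (rule prob_space_law)

sublocale E: prob_space "env G" by (rule prob_space_env)

lemma drift_nonneg: "0 \<le> drift G h"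
proof (induction h)
  case (Cons c h)
  then show ?case using G_ge[of h] by simp
qed simp

lemma drift_pre_mono: "m \<le> n \<Longrightarrow> drift G (pre b m) \<le> drift G (pre b n)"
proof (induction n rule: dec_induct)
  case (step n)
  then show ?case using G_ge[of "pre b n"] by simp
qed simp

section \<open>Drift used up in one stack\<close>

lemma AE_recurring_law: "AE b in law G. \<forall>c. recurring c b"
proof -
  have "AE b in law G. \<forall>n. \<exists>m\<ge>n. b m \<noteq> (\<not> c)" for c
  proof (rule AE_not_eventually_const[OF G_nonneg G_le_1])
    show "max q (1 / 2) < 1" using q_less by simp
    show "(if \<not> c then G h else 1 - G h) \<le> max q (1 / 2)" for h
      using G_ge[of h] G_le[of h] by auto
  qed
  then have "AE b in law G. \<forall>c. \<forall>n. \<exists>m\<ge>n. b m \<noteq> (\<not> c)" by (simp add: AE_all_countable)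
  then show ?thesis by (auto simp: recurring_def)
qed

lemma AE_recurring: "AE a in env G. \<forall>x c. recurring c (a x)"
proof -
  have "AE a in env G. \<forall>c. recurring c (a x)" for x
    unfolding env_def by (rule AE_PiM_component) (auto simp: prob_space_law AE_recurring_law)
  then show ?thesis by (simp add: AE_all_countable)
qed

text \<open>The mean drift in a stack up to and including right arrow number
  \<open>w + 1\<close>.\<close>

definition consumed :: "nat \<Rightarrow> ennreal" where
  "consumed w = (\<integral>\<^sup>+b. ennreal (drift G (pre b (stop b w))) \<partial>law G)"

definition total_drift :: ennreal where
  "total_drift = (\<integral>\<^sup>+b. (SUP n. ennreal (drift G (pre b n))) \<partial>law G)"

lemma measurable_law_comp:
  fixes \<phi> :: "'c \<Rightarrow> ennreal"
  assumes "Y \<in> measurable bool_seq (count_space UNIV)"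
  shows "(\<lambda>b. \<phi> (Y b)) \<in> borel_measurable (law G)"
  using measurable_compose[OF assms, of \<phi> borel] by (simp cong: measurable_cong_sets)

lemmas measurable_drift_pre = measurable_law_comp[where \<phi>="\<lambda>h. ennreal (drift G h)", OF measurable_pre]

lemmas measurable_drift_stop = measurable_law_comp[where \<phi>="\<lambda>h. ennreal (drift G h)", OF measurable_pre_stop]

lemma total_drift_eq: "total_drift = (SUP n. ennreal (expect G n (drift G)))"
proof -
  have "total_drift = (SUP n. \<integral>\<^sup>+b. ennreal (drift G (pre b n)) \<partial>law G)"
    unfolding total_drift_def
    by (rule nn_integral_monotone_convergence_SUP)
       (auto simp: incseq_def le_fun_def measurable_drift_pre intro!: ennreal_leI drift_pre_mono)
  then show ?thesis by (simp add: nn_integral_law_pre G_nonneg G_le_1 drift_nonneg)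
qed

lemma consumed_le: "consumed w \<le> total_drift"
  unfolding consumed_def total_drift_def by (intro nn_integral_mono SUP_upper2) auto

lemma consumed_mono: "w \<le> w' \<Longrightarrow> consumed w \<le> consumed w'"
  unfolding consumed_def using AE_recurring_law
  by (intro nn_integral_mono_AE) (auto elim!: eventually_mono intro!: ennreal_leI drift_pre_mono stop_mono)

text \<open>\<open>stop b w\<close> exceeds \<open>w\<close>, so the segments exhaust the stack, and
  monotone convergence applies.\<close>

lemma SUP_consumed: "(SUP w. consumed w) = total_drift"
proof -
  have "(SUP w. consumed w) = (\<integral>\<^sup>+b. (SUP w. ennreal (drift G (pre b (stop b w)))) \<partial>law G)"
    unfolding consumed_def
  proof (rule nn_integral_monotone_convergence_SUP_AE[symmetric])
    show "AE b in law G. ennreal (drift G (pre b (stop b w))) \<le> ennreal (drift G (pre b (stop b (Suc w))))" for w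
      using AE_recurring_law by eventually_elim (auto intro!: ennreal_leI drift_pre_mono stop_mono)
  qed (rule measurable_drift_stop)
  also have "\<dots> = total_drift"
    unfolding total_drift_def
  proof (rule nn_integral_cong_AE, use AE_recurring_law in eventually_elim)
    fix b :: "nat \<Rightarrow> bool" assume b: "\<forall>c. recurring c b"
    show "(SUP w. ennreal (drift G (pre b (stop b w)))) = (SUP n. ennreal (drift G (pre b n)))"
    proof (rule antisym)
      show "(SUP w. ennreal (drift G (pre b (stop b w)))) \<le> (SUP n. ennreal (drift G (pre b n)))"
        by (intro SUP_least SUP_upper2) auto
      show "(SUP n. ennreal (drift G (pre b n))) \<le> (SUP w. ennreal (drift G (pre b (stop b w))))"
      proof (intro SUP_least)
        fix n
        have "n \<le> stop b n" using stop_gt[of b n] b by simp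
        then have "ennreal (drift G (pre b n)) \<le> ennreal (drift G (pre b (stop b n)))"
          by (intro ennreal_leI drift_pre_mono)
        also have "\<dots> \<le> (SUP w. ennreal (drift G (pre b (stop b w))))" by (rule SUP_upper) simp
        finally show "ennreal (drift G (pre b n)) \<le> \<dots>" .
      qed
    qed
  qed
  finally show ?thesis .
qed

text \<open>Optional stopping at right arrow number \<open>w + 1\<close>: left arrows plus drift
  balance the right arrows in mean. The passage from bounded times to the stopping time yields an
  inequality.\<close>

lemma lefts_consumed: "(\<integral>\<^sup>+b. of_nat (lefts b w) \<partial>law G) + consumed w \<le> of_nat (Suc w)"
proof -
  \<comment> \<open>Reading continues while there are at most \<open>w\<close> right arrows, so a
    stopped history contains at most \<open>w + 1\<close> of them.\<close>
  define C where "C h \<longleftrightarrow> count_list h True \<le> w" for h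
  define \<psi> where "\<psi> h = real (count_list (stp C h) False) + drift G (stp C h)" for h
  have \<psi>0: "0 \<le> \<psi> h" for h using drift_nonneg by (simp add: \<psi>_def)
  have "\<psi> h \<le> \<psi> (c # h)" for c h
    using G_ge[of "stp C h"] by (auto simp: \<psi>_def)
  then have \<psi>_mono: "\<psi> (pre b m) \<le> \<psi> (pre b n)" if "m \<le> n" for b m n
    using lift_Suc_mono_le[of "\<lambda>n. \<psi> (pre b n)" m n] that by simp
  have le: "real (count_list (stp C h) True) \<le> real (Suc w)" for h
    by (induction h) (auto simp: C_def)
  have "expect G n \<psi> = expect G n (\<lambda>h. real (count_list (stp C h) True))" for n
    using optional_stopping[of G n C] unfolding \<psi>_def by (simp add: expect_diff expect_add)
  moreover have "expect G n (\<lambda>h. real (count_list (stp C h) True)) \<le> expect G n (\<lambda>_. real (Suc w))" for n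
    by (rule expect_mono[OF G_nonneg G_le_1 le])
  ultimately have exp_le: "expect G n \<psi> \<le> real (Suc w)" for n
    by simp
  have "(\<integral>\<^sup>+b. of_nat (lefts b w) \<partial>law G) + consumed w
      = (\<integral>\<^sup>+b. of_nat (lefts b w) + ennreal (drift G (pre b (stop b w))) \<partial>law G)"
    unfolding consumed_def by (intro nn_integral_add[symmetric] measurable_drift_stop measurable_law_comp measurable_lefts)
  also have "\<dots> \<le> (\<integral>\<^sup>+b. (SUP n. ennreal (\<psi> (pre b n))) \<partial>law G)"
  proof (rule nn_integral_mono_AE, use AE_recurring_law in eventually_elim)
    fix b :: "nat \<Rightarrow> bool" assume "\<forall>c. recurring c b"
    then have b: "recurring True b" by simp
    have "m \<le> stop b w \<Longrightarrow> stp C (pre b m) = pre b m" for m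
    proof (induction m)
      case (Suc m)
      have "count_list (pre b m) True \<le> Suc w"
        using count_pre_mono[of m "stop b w" b True] count_stop[OF b, of w] Suc.prems by simp
      moreover have "count_list (pre b m) True \<noteq> Suc w"
        using not_less_Least[of m "\<lambda>m. count_list (pre b m) True = Suc w"] Suc.prems unfolding stop_def by auto
      ultimately have "C (pre b m)" by (simp add: C_def)
      then show ?case using Suc by simp
    qed simp
    then have "\<psi> (pre b (stop b w)) = real (lefts b w) + drift G (pre b (stop b w))"
      by (simp add: \<psi>_def lefts_def)
    then have "of_nat (lefts b w) + ennreal (drift G (pre b (stop b w))) = ennreal (\<psi> (pre b (stop b w)))"
      using drift_nonneg by (simp add: ennreal_of_nat_eq_real_of_nat)
    also have "\<dots> \<le> (SUP n. ennreal (\<psi> (pre b n)))" by (rule SUP_upper) simp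
    finally show "of_nat (lefts b w) + ennreal (drift G (pre b (stop b w))) \<le> \<dots>" .
  qed
  also have "\<dots> = (SUP n. \<integral>\<^sup>+b. ennreal (\<psi> (pre b n)) \<partial>law G)"
    by (rule nn_integral_monotone_convergence_SUP) (auto simp: incseq_def le_fun_def intro!: ennreal_leI \<psi>_mono measurable_law_comp[where \<phi>="\<lambda>h. ennreal (\<psi> h)", OF measurable_pre])
  also have "\<dots> \<le> ennreal (real (Suc w))"
  proof (intro SUP_least)
    fix n
    have "(\<integral>\<^sup>+b. ennreal (\<psi> (pre b n)) \<partial>law G) = ennreal (expect G n \<psi>)"
      by (rule nn_integral_law_pre[OF G_nonneg G_le_1 \<psi>0])
    then show "(\<integral>\<^sup>+b. ennreal (\<psi> (pre b n)) \<partial>law G) \<le> ennreal (real (Suc w))"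
      using exp_le[of n] by (simp only: ennreal_leI)
  qed
  also have "\<dots> = of_nat (Suc w)" by (simp only: ennreal_of_nat_eq_real_of_nat)
  finally show ?thesis .
qed

section \<open>The Markov chain of left-step counts\<close>

fun chain :: "nat \<Rightarrow> (nat \<Rightarrow> ennreal) \<Rightarrow> ennreal" where
  "chain 0 \<phi> = \<phi> 0"
| "chain (Suc m) \<phi> = chain m (\<lambda>w. \<integral>\<^sup>+b. \<phi> (lefts b w) \<partial>law G)"

text \<open>Stands for dependence on the stacks below \<open>y\<close> only. Invariance under
  changing one stack is what resampling a single site requires.\<close>

definition past :: "int \<Rightarrow> (int \<Rightarrow> nat \<Rightarrow> bool) set \<Rightarrow> bool" where
  "past y A \<longleftrightarrow> A \<in> sets (env G) \<and> (\<forall>a x t. y \<le> x \<longrightarrow> (a(x := t) \<in> A \<longleftrightarrow> a \<in> A))"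

lemma past_mono: "past y A \<Longrightarrow> y \<le> z \<Longrightarrow> past z A"
  unfolding past_def by auto

lemma past_UNIV: "past y UNIV"
  unfolding past_def using sets.top[of "env G"] by simp

lemma past_crossings: "past (int m) {a. P (crossings a 0 m)}"
  unfolding past_def by (auto intro!: sets_env pred_crossings simp: crossings_upd_right)

lemma measurable_site:
  fixes \<psi> :: "(nat \<Rightarrow> bool) \<Rightarrow> nat \<Rightarrow> ennreal"
  assumes \<psi>: "\<And>w. (\<lambda>b. \<psi> b w) \<in> borel_measurable bool_seq"
  shows "(\<lambda>a. \<psi> (a y) (crossings a x m)) \<in> borel_measurable (env G)"
proof -
  have "(\<lambda>a. \<psi> (a y) w) \<in> borel_measurable (env G)" for w
    by (rule measurable_compose[OF env_component \<psi>])
  from measurable_compose_countable[where f="\<lambda>w a. \<psi> (a y) w", OF this measurable_crossings]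
  show ?thesis .
qed

text \<open>The stack at \<open>y\<close> affects neither \<open>A\<close> nor the chain started at
  \<open>y + 1\<close>, so it may be integrated out first.\<close>

lemma nn_integral_resample_site:
  assumes A: "past y A" and \<psi>: "\<And>w. (\<lambda>b. \<psi> b w) \<in> borel_measurable bool_seq"
  shows "(\<integral>\<^sup>+a. indicator A a * \<psi> (a y) (crossings a (y + 1) m) \<partial>env G)
       = (\<integral>\<^sup>+a. indicator A a * (\<integral>\<^sup>+b. \<psi> b (crossings a (y + 1) m) \<partial>law G) \<partial>env G)"
proof -
  have [measurable]: "A \<in> sets (env G)" using A by (simp add: past_def)
  have \<psi>': "(\<lambda>b. \<psi> b w) \<in> borel_measurable (law G)" for w
    using \<psi>[of w] by (simp cong: measurable_cong_sets)
  have [measurable]: "(\<lambda>a. \<psi> (a y) (crossings a (y + 1) m)) \<in> borel_measurable (env G)"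
    by (rule measurable_site[OF \<psi>])
  have "(\<integral>\<^sup>+a. indicator A a * \<psi> (a y) (crossings a (y + 1) m) \<partial>env G)
     = (\<integral>\<^sup>+a. (\<integral>\<^sup>+t. indicator A (a(y := t)) * \<psi> ((a(y := t)) y) (crossings (a(y := t)) (y + 1) m) \<partial>law G) \<partial>env G)"
    unfolding env_def
    by (rule nn_integral_PiM_resample[OF prob_space_law, where i=y], fold env_def) measurable
  also have "\<dots> = (\<integral>\<^sup>+a. (\<integral>\<^sup>+t. indicator A a * \<psi> t (crossings a (y + 1) m) \<partial>law G) \<partial>env G)"
    using A by (intro nn_integral_cong) (auto simp: past_def crossings_upd_left indicator_def)
  also have "\<dots> = (\<integral>\<^sup>+a. indicator A a * (\<integral>\<^sup>+b. \<psi> b (crossings a (y + 1) m) \<partial>law G) \<partial>env G)"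
    by (intro nn_integral_cong nn_integral_cmult \<psi>')
  finally show ?thesis .
qed

lemma borel_measurable_crossings [measurable]:
  fixes \<phi> :: "nat \<Rightarrow> ennreal"
  shows "(\<lambda>a. \<phi> (crossings a y m)) \<in> borel_measurable (env G)"
  by (rule measurable_compose[OF measurable_crossings]) simp

text \<open>The Markov property, peeling off the stack at \<open>y\<close>; an event in the past of
  \<open>y\<close> is also in the past of \<open>y + 1\<close>.\<close>

lemma nn_integral_chain:
  "past y A \<Longrightarrow> (\<integral>\<^sup>+a. indicator A a * \<phi> (crossings a y m) \<partial>env G) = emeasure (env G) A * chain m \<phi>"
proof (induction m arbitrary: y \<phi>)
  case 0
  then have [measurable]: "A \<in> sets (env G)" by (simp add: past_def)
  show ?case by (simp add: nn_integral_multc)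
next
  case (Suc m)
  have \<phi>: "(\<lambda>b. \<phi> (lefts b w)) \<in> borel_measurable bool_seq" for w
    by (rule measurable_compose[OF measurable_lefts]) simp
  have "(\<integral>\<^sup>+a. indicator A a * \<phi> (crossings a y (Suc m)) \<partial>env G)
      = (\<integral>\<^sup>+a. indicator A a * (\<integral>\<^sup>+b. \<phi> (lefts b (crossings a (y + 1) m)) \<partial>law G) \<partial>env G)"
    using nn_integral_resample_site[OF Suc.prems, of "\<lambda>b w. \<phi> (lefts b w)" m] \<phi> by simp
  also have "\<dots> = emeasure (env G) A * chain m (\<lambda>w. \<integral>\<^sup>+b. \<phi> (lefts b w) \<partial>law G)"
    using past_mono[OF Suc.prems, of "y + 1"] by (intro Suc.IH) auto
  finally show ?case by simp
qed

text \<open>So \<open>chain m \<phi>\<close> is the mean of \<open>\<phi>\<close> after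
  \<open>m\<close> transitions from state \<open>0\<close>, where a transition takes
  \<open>w\<close> to \<open>lefts b w\<close> with a fresh stack \<open>b\<close>. It is the same
  for every \<open>y\<close>.\<close>

lemma chain_eq: "chain m \<phi> = (\<integral>\<^sup>+a. \<phi> (crossings a y m) \<partial>env G)"
  using nn_integral_chain[OF past_UNIV, of \<phi> y m] E.emeasure_space_1 by simp

section \<open>Zero-one law for unboundedness of the chain\<close>

lemma AE_crossings_mono: "AE a in env G. \<forall>x m m'. m \<le> m' \<longrightarrow> crossings a x m \<le> crossings a x m'"
  using AE_recurring by eventually_elim (auto intro: crossings_mono)

definition unbounded :: "int \<Rightarrow> (int \<Rightarrow> nat \<Rightarrow> bool) set" where
  "unbounded y = {a. \<forall>r. \<exists>m. r < crossings a y m}"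

lemma pred_crossings_greater [measurable]: "Measurable.pred (env G) (\<lambda>a. r < crossings a y m)"
  by (rule pred_crossings)

lemma sets_unbounded [measurable]: "unbounded y \<in> sets (env G)"
  unfolding unbounded_def by (rule sets_env) measurable

lemma sets_exceed [measurable]: "{a. \<exists>m. r < crossings a y m} \<in> sets (env G)" "{a. r < crossings a y m} \<in> sets (env G)"
  by (rule sets_env, measurable)+

lemma measure_crossings_LIMSEQ:
  assumes [measurable]: "B \<in> sets (env G)"
  shows "(\<lambda>m. measure (env G) (B \<inter> {a. r < crossings a y m})) \<longlonglongrightarrow> measure (env G) (B \<inter> {a. \<exists>m. r < crossings a y m})"
proof -
  \<comment> \<open>Monotonicity in \<open>m\<close> holds only almost surely; these events increase
    everywhere and differ from the original ones by null sets.\<close>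
  let ?A = "\<lambda>m. B \<inter> {a. \<exists>m'\<le>m. r < crossings a y m'}"
  have [measurable]: "{a. \<exists>m'\<le>m. r < crossings a y m'} \<in> sets (env G)" for m
    by (rule sets_env) measurable
  have "(\<lambda>m. measure (env G) (?A m)) \<longlonglongrightarrow> measure (env G) (\<Union>m. ?A m)"
    by (rule E.finite_Lim_measure_incseq) (auto simp: incseq_def intro: order_trans)
  also have "(\<Union>m. ?A m) = B \<inter> {a. \<exists>m. r < crossings a y m}" by auto
  also have "(\<lambda>m. measure (env G) (?A m)) = (\<lambda>m. measure (env G) (B \<inter> {a. r < crossings a y m}))"
  proof (rule ext, rule measure_eq_AE)
    fix m
    show "AE a in env G. a \<in> ?A m \<longleftrightarrow> a \<in> B \<inter> {a. r < crossings a y m}"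
      using AE_crossings_mono by eventually_elim (auto intro: less_le_trans)
  qed measurable
  finally show ?thesis .
qed

lemma measure_unbounded_LIMSEQ:
  assumes [measurable]: "B \<in> sets (env G)"
  shows "(\<lambda>r. measure (env G) (B \<inter> {a. \<exists>m. r < crossings a y m})) \<longlonglongrightarrow> measure (env G) (B \<inter> unbounded y)"
proof -
  have "(\<lambda>r. measure (env G) (B \<inter> {a. \<exists>m. r < crossings a y m})) \<longlonglongrightarrow> measure (env G) (\<Inter>r. B \<inter> {a. \<exists>m. r < crossings a y m})"
    by (rule E.finite_Lim_measure_decseq) (auto simp: decseq_def intro: le_less_trans)
  also have "(\<Inter>r. B \<inter> {a. \<exists>m. r < crossings a y m}) = B \<inter> unbounded y"
    by (auto simp: unbounded_def)
  finally show ?thesis .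
qed

lemma measure_past_crossings:
  assumes "past y A"
  shows "measure (env G) (A \<inter> {a. r < crossings a y m}) = measure (env G) A * measure (env G) {a. r < crossings a y m}"
proof -
  let ?\<phi> = "\<lambda>w. indicator {r<..} w :: ennreal"
  have [measurable]: "A \<in> sets (env G)" using assms by (simp add: past_def)
  have "emeasure (env G) (A' \<inter> {a. r < crossings a y m}) = (\<integral>\<^sup>+a. indicator A' a * ?\<phi> (crossings a y m) \<partial>env G)"
    if [measurable]: "A' \<in> sets (env G)" for A'
  proof -
    have "emeasure (env G) (A' \<inter> {a. r < crossings a y m}) = (\<integral>\<^sup>+a. indicator (A' \<inter> {a. r < crossings a y m}) a \<partial>env G)"
      by simp
    also have "\<dots> = (\<integral>\<^sup>+a. indicator A' a * ?\<phi> (crossings a y m) \<partial>env G)"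
      by (intro nn_integral_cong) (auto split: split_indicator)
    finally show ?thesis .
  qed
  from this[of A] this[of UNIV] nn_integral_chain[OF assms, of ?\<phi> m] nn_integral_chain[OF past_UNIV, of ?\<phi> y m]
  have "emeasure (env G) (A \<inter> {a. r < crossings a y m}) = emeasure (env G) A * emeasure (env G) {a. r < crossings a y m}"
    using sets.top[of "env G"] E.emeasure_space_1 by simp
  then show ?thesis by (simp add: E.emeasure_eq_measure ennreal_mult''[symmetric])
qed

text \<open>Independence passes through two monotone limits, first in \<open>m\<close> and then in
  \<open>r\<close>.\<close>

lemma measure_past_unbounded:
  assumes "past y A"
  shows "measure (env G) (A \<inter> unbounded y) = measure (env G) A * measure (env G) (unbounded y)"
proof -
  have [measurable]: "A \<in> sets (env G)" using assms by (simp add: past_def)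
  have "(\<lambda>m. measure (env G) A * measure (env G) {a. r < crossings a y m})
      \<longlonglongrightarrow> measure (env G) A * measure (env G) {a. \<exists>m. r < crossings a y m}" for r
    using measure_crossings_LIMSEQ[of UNIV r y] sets.top[of "env G"] by (intro tendsto_intros) simp
  moreover have "(\<lambda>m. measure (env G) A * measure (env G) {a. r < crossings a y m})
      \<longlonglongrightarrow> measure (env G) (A \<inter> {a. \<exists>m. r < crossings a y m})" for r
    using measure_crossings_LIMSEQ[of A r y] by (simp add: measure_past_crossings[OF assms])
  ultimately have eq: "measure (env G) (A \<inter> {a. \<exists>m. r < crossings a y m})
      = measure (env G) A * measure (env G) {a. \<exists>m. r < crossings a y m}" for r
    using LIMSEQ_unique by blast
  have "(\<lambda>r. measure (env G) A * measure (env G) {a. \<exists>m. r < crossings a y m})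
      \<longlonglongrightarrow> measure (env G) A * measure (env G) (unbounded y)"
    using measure_unbounded_LIMSEQ[of UNIV y] sets.top[of "env G"] by (intro tendsto_intros) simp
  moreover have "(\<lambda>r. measure (env G) A * measure (env G) {a. \<exists>m. r < crossings a y m})
      \<longlonglongrightarrow> measure (env G) (A \<inter> unbounded y)"
    using measure_unbounded_LIMSEQ[of A y] by (simp add: eq)
  ultimately show ?thesis using LIMSEQ_unique by blast
qed

text \<open>The chain ending at \<open>x\<close> is obtained from the one ending at
  \<open>x + 1\<close> by \<open>lefts (a x)\<close>, which is monotone and unbounded.\<close>

lemma unbounded_step:
  assumes rec: "\<And>x c. recurring c (a x)"
  shows "a \<in> unbounded (x + 1) \<longleftrightarrow> a \<in> unbounded x"
proof
  assume u: "a \<in> unbounded (x + 1)"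
  show "a \<in> unbounded x" unfolding unbounded_def
  proof safe
    fix r
    obtain w where w: "Suc r \<le> lefts (a x) w" using lefts_unbounded[OF rec rec] by blast
    obtain m where "w < crossings a (x + 1) m" using u unfolding unbounded_def by blast
    then have "lefts (a x) w \<le> crossings a x (Suc m)" by (simp add: lefts_mono[OF rec])
    then show "\<exists>m. r < crossings a x m" using w by (intro exI[of _ "Suc m"]) simp
  qed
next
  assume u: "a \<in> unbounded x"
  show "a \<in> unbounded (x + 1)" unfolding unbounded_def
  proof safe
    fix r
    obtain m where m: "lefts (a x) r < crossings a x m" using u unfolding unbounded_def by blast
    then obtain m' where m': "m = Suc m'" by (cases m) auto
    have "r < crossings a (x + 1) m'"
      by (rule ccontr) (use m lefts_mono[OF rec, of "crossings a (x + 1) m'" r x] in \<open>simp add: m'\<close>)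
    then show "\<exists>m. r < crossings a (x + 1) m" by blast
  qed
qed

lemma AE_unbounded_shift: "AE a in env G. a \<in> unbounded (int n) \<longleftrightarrow> a \<in> unbounded 0"
  using AE_recurring
proof eventually_elim
  fix a :: "int \<Rightarrow> nat \<Rightarrow> bool" assume "\<forall>x c. recurring c (a x)"
  then have step: "a \<in> unbounded (x + 1) \<longleftrightarrow> a \<in> unbounded x" for x
    by (intro unbounded_step) blast
  show "a \<in> unbounded (int n) \<longleftrightarrow> a \<in> unbounded 0"
  proof (induction n)
    case (Suc n)
    then show ?case using step[of "int n"] by (simp add: add.commute)
  qed simp
qed

text \<open>The event is determined by the sites beyond any given one, while it is also a limit of events
  each depending on finitely many sites; hence it is independent of itself.\<close>
lemma unbounded_zero_one: "measure (env G) (unbounded 0) \<in> {0, 1}"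
proof -
  let ?U = "unbounded 0"
  \<comment> \<open>Almost surely \<open>unbounded 0\<close> coincides with
    \<open>unbounded (int m)\<close>, which is independent of the stacks below
    \<open>m\<close>.\<close>
  have eq1: "measure (env G) (?U \<inter> {a. r < crossings a 0 m}) = measure (env G) {a. r < crossings a 0 m} * measure (env G) ?U" for r m
  proof -
    have "measure (env G) (?U \<inter> {a. r < crossings a 0 m}) = measure (env G) ({a. r < crossings a 0 m} \<inter> unbounded (int m))"
      using AE_unbounded_shift[of m] by (intro measure_eq_AE) (auto elim!: eventually_mono)
    moreover have "measure (env G) (unbounded (int m)) = measure (env G) ?U"
      using AE_unbounded_shift[of m] by (intro measure_eq_AE) auto
    ultimately show ?thesis
      using measure_past_unbounded[OF past_crossings[of m "\<lambda>w. r < w"]] by simp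
  qed
  have "(\<lambda>m. measure (env G) {a. r < crossings a 0 m} * measure (env G) ?U)
      \<longlonglongrightarrow> measure (env G) {a. \<exists>m. r < crossings a 0 m} * measure (env G) ?U" for r
    using measure_crossings_LIMSEQ[of UNIV r 0] sets.top[of "env G"] by (intro tendsto_intros) simp
  moreover have "(\<lambda>m. measure (env G) {a. r < crossings a 0 m} * measure (env G) ?U)
      \<longlonglongrightarrow> measure (env G) (?U \<inter> {a. \<exists>m. r < crossings a 0 m})" for r
    using measure_crossings_LIMSEQ[of ?U r 0] by (simp add: eq1)
  ultimately have eq2: "measure (env G) (?U \<inter> {a. \<exists>m. r < crossings a 0 m})
      = measure (env G) {a. \<exists>m. r < crossings a 0 m} * measure (env G) ?U" for r
    using LIMSEQ_unique by blast
  have "(\<lambda>r. measure (env G) {a. \<exists>m. r < crossings a 0 m} * measure (env G) ?U)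
      \<longlonglongrightarrow> measure (env G) ?U * measure (env G) ?U"
    using measure_unbounded_LIMSEQ[of UNIV 0] sets.top[of "env G"] by (intro tendsto_intros) simp
  moreover have "(\<lambda>r. measure (env G) {a. \<exists>m. r < crossings a 0 m} * measure (env G) ?U)
      \<longlonglongrightarrow> measure (env G) (?U \<inter> ?U)"
    using measure_unbounded_LIMSEQ[of ?U 0] by (simp add: eq2)
  ultimately have "measure (env G) ?U * measure (env G) ?U = measure (env G) ?U"
    using LIMSEQ_unique by fastforce
  then show ?thesis by auto
qed

section \<open>Transience for total drift above 1\<close>

lemma sum_chain_consumed_le: "(\<Sum>j<m. chain j consumed) \<le> of_nat m"
proof -
  \<comment> \<open>Keeping the mean of the chain on the left makes the sum telescope: by
    \<open>lefts_consumed\<close> each transition changes this mean by at most 1 minus the mean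
    drift consumed.\<close>
  have "chain m of_nat + (\<Sum>j<m. chain j consumed) \<le> of_nat m"
  proof (induction m)
    case (Suc m)
    have "chain (Suc m) of_nat + chain m consumed
        = (\<integral>\<^sup>+a. (\<integral>\<^sup>+b. of_nat (lefts b (crossings a 0 m)) \<partial>law G) + consumed (crossings a 0 m) \<partial>env G)"
      unfolding chain.simps chain_eq[of m _ 0] by (rule nn_integral_add[symmetric]) measurable
    also have "\<dots> \<le> (\<integral>\<^sup>+a. of_nat (crossings a 0 m) + 1 \<partial>env G)"
      using lefts_consumed by (intro nn_integral_mono) (simp add: add.commute)
    also have "\<dots> = chain m of_nat + 1"
      unfolding chain_eq[of _ _ 0] using E.emeasure_space_1 by (subst nn_integral_add) auto
    finally have "chain (Suc m) of_nat + chain m consumed + (\<Sum>j<m. chain j consumed)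
        \<le> chain m of_nat + 1 + (\<Sum>j<m. chain j consumed)" by (rule add_right_mono)
    also have "\<dots> \<le> of_nat m + 1"
      using add_right_mono[OF Suc, of 1] by (simp add: ac_simps)
    finally show ?case by (simp add: ac_simps)
  qed simp
  then show ?thesis by (rule order_trans[rotated]) (simp add: add_increasing)
qed

text \<open>By the zero-one law it suffices to exclude probability 1. In that case the mean
  consumption per site increases to the total drift and eventually exceeds some
  \<open>c' > 1\<close>, against an average of at most 1.\<close>

lemma AE_bounded:
  assumes "1 < total_drift"
  shows "AE a in env G. a \<notin> unbounded 0"
proof -
  have "measure (env G) (unbounded 0) \<noteq> 1"
  proof
    assume "measure (env G) (unbounded 0) = 1"
    then have U: "AE a in env G. a \<in> unbounded 0" by (rule E.AE_prob_1)
    have "(SUP m. chain m consumed) = (\<integral>\<^sup>+a. (SUP m. consumed (crossings a 0 m)) \<partial>env G)"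
      unfolding chain_eq[of _ _ 0]
    proof (rule nn_integral_monotone_convergence_SUP_AE[symmetric])
      show "AE a in env G. consumed (crossings a 0 m) \<le> consumed (crossings a 0 (Suc m))" for m
        using AE_crossings_mono by eventually_elim (auto intro!: consumed_mono simp del: crossings.simps)
    qed measurable
    also have "\<dots> \<ge> (\<integral>\<^sup>+a. total_drift \<partial>env G)"
    proof (rule nn_integral_mono_AE, use U in eventually_elim)
      fix a assume a: "a \<in> unbounded 0"
      show "total_drift \<le> (SUP m. consumed (crossings a 0 m))"
        unfolding SUP_consumed[symmetric]
      proof (rule SUP_least)
        fix w
        obtain m where "w < crossings a 0 m" using a unfolding unbounded_def by blast
        then show "consumed w \<le> (SUP m. consumed (crossings a 0 m))"
          by (intro SUP_upper2[of m]) (auto intro: consumed_mono)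
      qed
    qed
    finally have "total_drift \<le> (SUP m. chain m consumed)" using E.emeasure_space_1 by simp
    then have "1 < (SUP m. chain m consumed)" using assms by (rule less_le_trans[rotated])
    then obtain J where J: "1 < chain J consumed" by (auto simp: less_SUP_iff)
    then obtain c where c: "1 < c" "c < chain J consumed" using dense by blast
    then obtain c' where c': "c = ennreal c'" "0 \<le> c'" by (cases c) auto
    have c1: "1 < c'" using c(1) c' by (simp add: ennreal_less_iff flip: ennreal_1)
    have mono: "chain J consumed \<le> chain j consumed" if "J \<le> j" for j
      unfolding chain_eq[of _ _ 0] using AE_crossings_mono that
      by (intro nn_integral_mono_AE) (auto elim!: eventually_mono intro!: consumed_mono)
    \<comment> \<open>With this \<open>n\<close>, the \<open>n\<close> sites after the first
      \<open>J\<close> alone consume \<open>n * c' > J + n\<close>.\<close>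
    obtain n :: nat where n: "real J < real n * (c' - 1)"
      using reals_Archimedean3[of "c' - 1"] c1 by auto
    have "ennreal (real n * c') = (\<Sum>j\<in>{J..<J + n}. ennreal c')"
      using c'(2) by (simp add: ennreal_mult ennreal_of_nat_eq_real_of_nat)
    also have "\<dots> \<le> (\<Sum>j\<in>{J..<J + n}. chain j consumed)"
      using c(2) mono unfolding c'(1) by (intro sum_mono) (auto intro: order_trans less_imp_le)
    also have "\<dots> \<le> (\<Sum>j<J + n. chain j consumed)"
      by (intro sum_mono2) auto
    also have "\<dots> \<le> of_nat (J + n)" by (rule sum_chain_consumed_le)
    also have "\<dots> = ennreal (real (J + n))" by (simp only: ennreal_of_nat_eq_real_of_nat)
    finally have "real n * c' \<le> real (J + n)" by (subst (asm) ennreal_le_iff) auto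
    with n show False by (simp add: algebra_simps)
  qed
  then have "measure (env G) (unbounded 0) = 0" using unbounded_zero_one by auto
  then show ?thesis by (intro AE_not_in) (auto simp: null_sets_def E.emeasure_eq_measure)
qed

end

section \<open>Exit of the walk from an interval\<close>

lemma stp_walk: "\<exists>j\<le>n. stp C (walk a n) = walk a j \<and> (\<forall>i<j. C (walk a i))"
proof (induction n)
  case (Suc n)
  then obtain j where j: "j \<le> n" "stp C (walk a n) = walk a j" "\<forall>i<j. C (walk a i)" by blast
  show ?case
  proof (cases "C (stp C (walk a n))")
    case True
    then have eq: "stp C (walk a n) = walk a n" by (rule stp_eq)
    then have "j = n" using j(2) length_walk by metis
    moreover have "C (walk a n)" using True eq by simp
    ultimately show ?thesis using j eq True by (intro exI[of _ "Suc n"]) (auto simp: less_Suc_eq)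
  qed (use j in \<open>auto intro!: exI[of _ j]\<close>)
qed simp

lemma stp_walk_alive: "(\<And>i. i < n \<Longrightarrow> C (walk a i)) \<Longrightarrow> stp C (walk a n) = walk a n"
  by (induction n) auto

lemma count_site_mono: "m \<le> n \<Longrightarrow> count_list (site x (walk a m)) c \<le> count_list (site x (walk a n)) c"
  by (induction n rule: dec_induct) auto

lemma site_walk_empty: "site x (walk a n) = [] \<longleftrightarrow> (\<forall>i<n. pos (walk a i) \<noteq> x)"
proof -
  have "site x (walk a n) = [] \<longleftrightarrow> card {m. m < n \<and> pos (walk a m) = x} = 0"
    by (subst length_site_walk[symmetric]) simp
  then show ?thesis by auto
qed

definition confined :: "int \<Rightarrow> int \<Rightarrow> bool list \<Rightarrow> bool" where
  "confined lo hi h \<longleftrightarrow> lo < pos h \<and> pos h < hi"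

lemma pos_stp_confined:
  assumes "lo \<le> 0" "0 \<le> hi"
  shows "lo \<le> pos (stp (confined lo hi) h) \<and> pos (stp (confined lo hi) h) \<le> hi"
  using assms by (induction h) (auto simp: confined_def)

context
  fixes a :: "int \<Rightarrow> nat \<Rightarrow> bool" and T k :: nat
  assumes rec: "\<And>x. recurring True (a x)"
    and T: "pos (walk a T) = int k" "site (int k) (walk a T) = []"
begin

lemma confined_before_hit: "(\<And>i. i < j \<Longrightarrow> confined (-1) (int k) (walk a i)) \<Longrightarrow> j \<le> T"
  using T(1) by (force simp: confined_def not_le[symmetric])

text \<open>A site seen before the exit was reached before \<open>-1\<close>, so no left step from
  \<open>0\<close> precedes its first visit.\<close>

lemma confined_crossings_zero:
  assumes conf: "\<And>i. i < j \<Longrightarrow> confined (-1) (int k) (walk a i)" and x: "site (int x) (walk a j) \<noteq> []"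
  shows "crossings a 0 x = 0"
proof -
  obtain i where i: "i < j" "pos (walk a i) = int x" using x by (auto simp: site_walk_empty)
  obtain S where S: "S \<le> i" "pos (walk a S) = int x" "site (int x) (walk a S) = []"
    using first_hit_exists[OF i(2)] by blast
  have "pos (walk a i') \<noteq> -1" if "i' < S" for i'
    using conf[of i'] that S(1) i(1) by (simp add: confined_def)
  then have "site (- 1) (walk a S) = []" by (simp add: site_walk_empty)
  then have "count_list (site 0 (walk a S)) False = 0"
    using flow[of "-1" "walk a S"] S(2) by (auto split: if_splits)
  then show ?thesis using first_hit(1)[OF rec S(2,3), of x] by simp
qed

lemma crossings_pos_if_exit_left:
  assumes conf: "\<And>i. i < j \<Longrightarrow> confined (-1) (int k) (walk a i)" and "pos (walk a j) = -1"
  shows "crossings a 0 k \<noteq> 0"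
proof -
  have "1 \<le> count_list (site 0 (walk a j)) False"
    using flow[of "-1" "walk a j"] assms(2) by (auto split: if_splits)
  also have "\<dots> \<le> count_list (site 0 (walk a T)) False"
    by (intro count_site_mono confined_before_hit conf)
  finally show ?thesis using first_hit(1)[OF rec T, of k] by simp
qed

text \<open>With the preceding lemma, \<open>crossings a 0 k = 0\<close> is recognized as the event
  that \<open>k\<close> is reached before \<open>-1\<close>.\<close>

lemma confined_if_crossings_zero:
  assumes "crossings a 0 k = 0" "i < T"
  shows "confined (-1) (int k) (walk a i)"
proof -
  have "count_list (site 0 (walk a i)) False \<le> 0"
    using count_site_mono[of i T 0 a False] assms first_hit(1)[OF rec T, of k] by simp
  then have "0 \<le> pos (walk a i)" using flow[of "-1" "walk a i"] by (auto split: if_splits)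
  moreover have "pos (walk a i) \<noteq> int k" using T(2) assms(2) by (auto simp: site_walk_empty)
  moreover have "\<not> int k < pos (walk a i)"
  proof
    assume "int k < pos (walk a i)"
    then have "site (int k) (walk a i) \<noteq> []" using flow[of "int k" "walk a i"] by auto
    moreover have "site (int k) (walk a i) = []" using T(2) assms(2) by (auto simp: site_walk_empty)
    ultimately show False by simp
  qed
  ultimately show ?thesis by (auto simp: confined_def)
qed

end

context site_law
begin

section \<open>Optional stopping for the walk; every positive site is reached\<close>

abbreviation "W \<equiv> walk_predictor G"

lemma W_bounds: "1 / 2 \<le> W h" "0 \<le> W h" "W h \<le> 1"
  using G_ge G_nonneg G_le_1 by (auto simp: walk_predictor_def)

lemma drift_walk_nonneg: "0 \<le> drift W h"
proof (induction h)
  case (Cons c h)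
  then show ?case using W_bounds(1)[of h] by simp
qed simp

lemma expect_pos_stp: "expect W n (\<lambda>h. real_of_int (pos (stp C h))) = expect W n (\<lambda>h. drift W (stp C h))"
  using optional_stopping[of W n C] by (simp add: pos_count expect_diff)

lemma pred_walk [measurable]: "Measurable.pred (env G) (\<lambda>a. Q (walk a n))"
  by (rule measurable_compose[OF measurable_walk]) simp

lemma sets_walk [measurable]: "{a. Q (walk a n)} \<in> sets (env G)"
  by (rule sets_env) (rule pred_walk)

lemma measure_walk: "measure (env G) {a. Q (walk a n)} = expect W n (\<lambda>h. if Q h then 1 else 0)"
proof -
  have "emeasure (env G) {a. Q (walk a n)} = (\<integral>\<^sup>+a. indicator {a. Q (walk a n)} a \<partial>env G)"
    by simp
  also have "\<dots> = (\<integral>\<^sup>+a. ennreal (if Q (walk a n) then 1 else 0) \<partial>env G)"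
    by (intro nn_integral_cong) (auto split: split_indicator)
  also have "\<dots> = ennreal (expect W n (\<lambda>h. if Q h then 1 else 0))"
    by (rule nn_integral_walk) (auto simp: G_nonneg G_le_1)
  finally have "ennreal (measure (env G) {a. Q (walk a n)}) = ennreal (expect W n (\<lambda>h. if Q h then 1 else 0))"
    by (simp add: E.emeasure_eq_measure)
  moreover have "0 \<le> expect W n (\<lambda>h. if Q h then 1 else 0)"
    using expect_mono[of W n "\<lambda>_. 0" "\<lambda>h. if Q h then 1 else 0"] W_bounds by simp
  ultimately show ?thesis by simp
qed

text \<open>The stopped position has nonnegative mean, because the drift is nonnegative, and it is
  at most \<open>k\<close>, with equality to \<open>- m\<close> after an exit to the left.\<close>

lemma measure_exit_left_le:
  assumes "0 < k" "0 < m"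
  shows "real (k + m) * measure (env G) {a. pos (stp (confined (- int m) (int k)) (walk a n)) = - int m} \<le> real k"
proof -
  let ?C = "confined (- int m) (int k)"
  let ?ind = "\<lambda>h. if pos (stp ?C h) = - int m then 1 else 0 :: real"
  have "0 \<le> expect W n (\<lambda>h. drift W (stp ?C h))"
    using expect_mono[of W n "\<lambda>_. 0" "\<lambda>h. drift W (stp ?C h)"] W_bounds drift_walk_nonneg by simp
  also have "\<dots> = expect W n (\<lambda>h. real_of_int (pos (stp ?C h)))" by (rule expect_pos_stp[symmetric])
  also have "\<dots> \<le> expect W n (\<lambda>h. real k - real (k + m) * ?ind h)"
  proof (rule expect_mono)
    fix h
    show "real_of_int (pos (stp ?C h)) \<le> real k - real (k + m) * ?ind h"
      using pos_stp_confined[of "- int m" "int k" h] by auto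
  qed (use W_bounds in auto)
  also have "\<dots> = real k - real (k + m) * expect W n ?ind"
    by (simp only: expect_diff expect_cmult expect_const)
  finally show ?thesis using measure_walk[of "\<lambda>h. pos (stp ?C h) = - int m" n] by simp
qed

text \<open>A walk that never reaches \<open>k\<close> leaves every interval from \<open>-m\<close>
  to \<open>k\<close> at \<open>-m\<close>, which has probability at most
  \<open>k / (k + m)\<close>; let \<open>m\<close> grow.\<close>

lemma AE_hits: "AE a in env G. \<forall>k. \<exists>n. pos (walk a n) = int k"
proof -
  have "AE a in env G. \<exists>n. pos (walk a n) = int k" for k
  proof (cases "k = 0")
    case True
    then show ?thesis by (intro AE_I2 exI[of _ 0]) simp
  next
    case False
    then have k: "0 < k" by simp
    let ?N = "{a. \<forall>n. pos (walk a n) \<noteq> int k}"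
    have [measurable]: "?N \<in> sets (env G)" by (rule sets_env) measurable
    have le: "real (k + m) * measure (env G) ?N \<le> real k" if m: "0 < m" for m
    proof -
      let ?C = "confined (- int m) (int k)"
      let ?E = "\<lambda>n. {a. pos (stp ?C (walk a n)) = - int m}"
      have "?E n \<subseteq> ?E (Suc n)" for n by (auto simp: confined_def)
      then have inc: "incseq ?E" by (rule incseq_SucI)
      have lim: "(\<lambda>n. real (k + m) * measure (env G) (?E n)) \<longlonglongrightarrow> real (k + m) * measure (env G) (\<Union>n. ?E n)"
        by (intro tendsto_intros E.finite_Lim_measure_incseq inc) auto
      have "measure (env G) ?N \<le> measure (env G) (\<Union>n. ?E n)"
      proof (rule E.finite_measure_mono_AE)
        show "AE a in env G. a \<in> ?N \<longrightarrow> a \<in> (\<Union>n. ?E n)"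
          using AE_recurring
        proof eventually_elim
          fix a :: "int \<Rightarrow> nat \<Rightarrow> bool"
          assume rec: "\<forall>x c. recurring c (a x)"
          show "a \<in> ?N \<longrightarrow> a \<in> (\<Union>n. ?E n)"
          proof
            assume a: "a \<in> ?N"
            have ex: "\<exists>n. \<not> ?C (walk a n)"
              using exits_finite[of a "{- int m<..<int k}"] rec by (auto simp: confined_def)
            define n where "n = (LEAST n. \<not> ?C (walk a n))"
            have n: "\<not> ?C (walk a n)" using LeastI_ex[OF ex] by (simp add: n_def)
            have "stp ?C (walk a n) = walk a n"
              by (rule stp_walk_alive) (use not_less_Least n_def in blast)
            then have "pos (walk a n) = - int m"
              using n pos_stp_confined[of "- int m" "int k" "walk a n"] a by (auto simp: confined_def)
            then show "a \<in> (\<Union>n. ?E n)" using \<open>stp ?C (walk a n) = walk a n\<close> by (auto intro!: exI[of _ n])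
          qed
        qed
      qed measurable
      then have "real (k + m) * measure (env G) ?N \<le> real (k + m) * measure (env G) (\<Union>n. ?E n)"
        by (intro mult_left_mono) auto
      also have "\<dots> \<le> real k"
        by (rule LIMSEQ_le_const2[OF lim]) (use measure_exit_left_le[OF k m] in auto)
      finally show ?thesis .
    qed
    have "measure (env G) ?N = 0"
    proof (rule ccontr)
      assume "measure (env G) ?N \<noteq> 0"
      then have p: "0 < measure (env G) ?N" using measure_nonneg[of "env G" ?N] by linarith
      then obtain m :: nat where "real k < real m * measure (env G) ?N"
        using reals_Archimedean3 by blast
      moreover from this k have "0 < m" by (cases m) auto
      moreover have "0 \<le> real k * measure (env G) ?N" by simp
      moreover have "real k * measure (env G) ?N + real m * measure (env G) ?N \<le> real k"
        using le[OF \<open>0 < m\<close>] by (simp add: algebra_simps)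
      ultimately show False by linarith
    qed
    then show ?thesis
      by (intro AE_I[where N="?N"]) (auto simp: E.emeasure_eq_measure)
  qed
  then show ?thesis by (simp add: AE_all_countable)
qed

section \<open>Recurrence for total drift at most 1, via the probability of reaching
  \<open>k\<close> before \<open>-1\<close>\<close>

definition no_return :: "nat \<Rightarrow> real" where
  "no_return k = measure (env G) {a. crossings a 0 k = 0}"

lemma sets_crossings [measurable]: "{a. P (crossings a y m)} \<in> sets (env G)"
  by (rule sets_env) (rule pred_crossings)

text \<open>A site \<open>x\<close> can contribute only if it is reached before \<open>-1\<close>, an event depending on the stacks below
  \<open>x\<close>; its contribution is at most the drift used before the first visit to \<open>k\<close>, which depends on the
  stacks from \<open>x\<close> on.\<close>
lemma nn_integral_drift_stp_le:
  assumes "0 < k"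
  shows "(\<integral>\<^sup>+a. ennreal (drift W (stp (confined (-1) (int k)) (walk a n))) \<partial>env G)
    \<le> (\<Sum>x<k. ennreal (no_return x) * chain (k - Suc x) consumed)"
proof -
  let ?C = "confined (-1) (int k)"
  let ?Z = "\<lambda>x. {a. crossings a 0 x = 0}"
  let ?\<psi> = "\<lambda>b w. ennreal (drift G (pre b (stop b w)))"
  have \<psi>: "(\<lambda>b. ?\<psi> b w) \<in> borel_measurable bool_seq" for w
    by (rule measurable_compose[OF measurable_pre_stop]) simp
  note [measurable] = measurable_site[OF \<psi>]
  have "(\<integral>\<^sup>+a. ennreal (drift W (stp ?C (walk a n))) \<partial>env G)
    \<le> (\<integral>\<^sup>+a. (\<Sum>x<k. indicator (?Z x) a * ?\<psi> (a (int x)) (crossings a (int x + 1) (k - Suc x))) \<partial>env G)"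
  proof (rule nn_integral_mono_AE, use AE_recurring AE_hits in eventually_elim)
    fix a :: "int \<Rightarrow> nat \<Rightarrow> bool"
    assume "\<forall>x c. recurring c (a x)" and hits: "\<forall>k. \<exists>n. pos (walk a n) = int k"
    then have rec: "\<And>x. recurring True (a x)" by blast
    obtain T where T: "pos (walk a T) = int k" "site (int k) (walk a T) = []"
      using hits first_hit_exists by blast
    obtain j where j: "stp ?C (walk a n) = walk a j" "\<forall>i<j. ?C (walk a i)"
      using stp_walk[of n ?C a] by blast
    have jT: "j \<le> T" using confined_before_hit[OF rec T] j(2) by blast
    \<comment> \<open>Up to the exit only sites \<open>0, ..., k - 1\<close> are left, so the drift
      splits over these.\<close>
    have "drift W (walk a j) = (\<Sum>x\<in>int ` {..<k}. drift G (site x (walk a j)))"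
    proof (rule drift_walk)
      fix x assume x: "x \<notin> int ` {..<k}"
      have "pos (walk a i) \<noteq> x" if "i < j" for i
      proof -
        have "-1 < pos (walk a i)" "pos (walk a i) < int k" using j(2) that by (auto simp: confined_def)
        then have "pos (walk a i) \<in> int ` {..<k}"
          by (intro image_eqI[of _ _ "nat (pos (walk a i))"]) auto
        then show ?thesis using x by auto
      qed
      then show "site x (walk a j) = []" by (simp add: site_walk_empty)
    qed simp
    also have "\<dots> = (\<Sum>x<k. drift G (site (int x) (walk a j)))" by (simp add: sum.reindex)
    finally have "ennreal (drift W (stp ?C (walk a n))) = (\<Sum>x<k. ennreal (drift G (site (int x) (walk a j))))"
      using j(1) by (simp add: drift_nonneg)
    also have "\<dots> \<le> (\<Sum>x<k. indicator (?Z x) a * ?\<psi> (a (int x)) (crossings a (int x + 1) (k - Suc x)))"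
    proof (rule sum_mono)
      fix x assume "x \<in> {..<k}"
      then have x: "x < k" by simp
      show "ennreal (drift G (site (int x) (walk a j))) \<le> indicator (?Z x) a * ?\<psi> (a (int x)) (crossings a (int x + 1) (k - Suc x))"
      proof (cases "site (int x) (walk a j) = []")
        case False
        have "crossings a 0 x = 0" using confined_crossings_zero[OF rec T _ False] j(2) by blast
        \<comment> \<open>\<open>first_hit\<close> counts sites downwards from \<open>k\<close>;
          site \<open>x\<close> has number \<open>Suc (k - Suc x)\<close> there.\<close>
        have eqs: "int k - int (Suc (k - Suc x)) = int x" "int k - int (k - Suc x) = int x + 1"
          using x by (simp_all add: of_nat_diff)
        have "length (site (int x) (walk a T)) = stop (a (int x)) (crossings a (int x + 1) (k - Suc x))"
          using first_hit(2)[OF rec T, of "k - Suc x"] x unfolding eqs by simp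
        then have "length (site (int x) (walk a j)) \<le> stop (a (int x)) (crossings a (int x + 1) (k - Suc x))"
          using site_walk_mono[OF jT, of "int x" a] by simp
        then have "drift G (site (int x) (walk a j)) \<le> drift G (pre (a (int x)) (stop (a (int x)) (crossings a (int x + 1) (k - Suc x))))"
          by (subst site_walk) (rule drift_pre_mono)
        then show ?thesis using \<open>crossings a 0 x = 0\<close> by (simp add: ennreal_leI)
      qed simp
    qed
    finally show "ennreal (drift W (stp ?C (walk a n))) \<le> \<dots>" .
  qed
  also have "\<dots> = (\<Sum>x<k. \<integral>\<^sup>+a. indicator (?Z x) a * ?\<psi> (a (int x)) (crossings a (int x + 1) (k - Suc x)) \<partial>env G)"
    by (rule nn_integral_sum) measurable
  also have "\<dots> = (\<Sum>x<k. ennreal (no_return x) * chain (k - Suc x) consumed)"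
  proof (rule sum.cong[OF refl])
    fix x
    have past: "past (int x) (?Z x)" by (rule past_crossings)
    have "(\<integral>\<^sup>+a. indicator (?Z x) a * ?\<psi> (a (int x)) (crossings a (int x + 1) (k - Suc x)) \<partial>env G)
       = (\<integral>\<^sup>+a. indicator (?Z x) a * consumed (crossings a (int x + 1) (k - Suc x)) \<partial>env G)"
      unfolding consumed_def by (rule nn_integral_resample_site[OF past \<psi>])
    also have "\<dots> = emeasure (env G) (?Z x) * chain (k - Suc x) consumed"
      by (rule nn_integral_chain[OF past_mono[OF past]]) simp
    finally show "(\<integral>\<^sup>+a. indicator (?Z x) a * ?\<psi> (a (int x)) (crossings a (int x + 1) (k - Suc x)) \<partial>env G)
       = ennreal (no_return x) * chain (k - Suc x) consumed"
      by (simp add: no_return_def E.emeasure_eq_measure)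
  qed
  finally show ?thesis .
qed

lemma chain_consumed_le: "chain m consumed \<le> total_drift"
proof -
  have "chain m consumed \<le> (\<integral>\<^sup>+a. total_drift \<partial>env G)"
    unfolding chain_eq[of _ _ 0] by (intro nn_integral_mono consumed_le)
  then show ?thesis using E.emeasure_space_1 by simp
qed

text \<open>The mean stopped position on \<open>[0, k)\<close> equals the mean drift used, which is
  at most the sum. An exit at \<open>-1\<close> has probability at most
  \<open>1 - no_return k\<close>, and the probability of an exit at \<open>k\<close> has a limit of
  at least \<open>no_return k\<close>.\<close>

lemma no_return_le:
  assumes k: "0 < k" and fin: "total_drift \<le> 1"
  shows "real (k + 1) * no_return k \<le> 1 + (\<Sum>x<k. no_return x * enn2real (chain (k - Suc x) consumed))"
    (is "_ \<le> 1 + ?S")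
proof -
  let ?C = "confined (-1) (int k)"
  let ?R = "\<lambda>n. {a. pos (stp ?C (walk a n)) = int k}" and ?L = "\<lambda>n. {a. pos (stp ?C (walk a n)) = -1}"
  let ?Z = "{a. crossings a 0 k = 0}"
  have S0: "0 \<le> ?S" by (intro sum_nonneg mult_nonneg_nonneg) (auto simp: no_return_def)
  have chain_fin: "chain m consumed = ennreal (enn2real (chain m consumed))" for m
  proof -
    have "chain m consumed < top"
      by (rule le_less_trans[OF order_trans[OF chain_consumed_le fin]]) simp
    then show ?thesis by simp
  qed
  have 1: "real k * measure (env G) (?R n) - measure (env G) (?L n) \<le> ?S" for n
  proof -
    have "real k * measure (env G) (?R n) - measure (env G) (?L n)
       = expect W n (\<lambda>h. real k * (if pos (stp ?C h) = int k then 1 else 0) - (if pos (stp ?C h) = -1 then 1 else 0))"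
      using measure_walk[of "\<lambda>h. pos (stp ?C h) = int k" n] measure_walk[of "\<lambda>h. pos (stp ?C h) = -1" n]
      by (simp only: expect_diff expect_cmult)
    also have "\<dots> \<le> expect W n (\<lambda>h. real_of_int (pos (stp ?C h)))"
    proof (rule expect_mono)
      fix h
      show "real k * (if pos (stp ?C h) = int k then 1 else 0) - (if pos (stp ?C h) = -1 then 1 else 0) \<le> real_of_int (pos (stp ?C h))"
        using pos_stp_confined[of "-1" "int k" h] by auto
    qed (use W_bounds in auto)
    also have "\<dots> = expect W n (\<lambda>h. drift W (stp ?C h))" by (rule expect_pos_stp)
    also have "\<dots> \<le> ?S"
    proof -
      have "ennreal (expect W n (\<lambda>h. drift W (stp ?C h))) = (\<integral>\<^sup>+a. ennreal (drift W (stp ?C (walk a n))) \<partial>env G)"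
        by (rule nn_integral_walk[symmetric]) (auto simp: G_nonneg G_le_1 drift_walk_nonneg)
      also have "\<dots> \<le> (\<Sum>x<k. ennreal (no_return x) * chain (k - Suc x) consumed)"
        by (rule nn_integral_drift_stp_le[OF k])
      also have "\<dots> = (\<Sum>x<k. ennreal (no_return x * enn2real (chain (k - Suc x) consumed)))"
        by (intro sum.cong refl, subst chain_fin) (simp add: ennreal_mult' no_return_def)
      also have "\<dots> = ennreal ?S"
        by (rule sum_ennreal) (auto simp: no_return_def)
      finally show ?thesis using S0 by (simp add: ennreal_le_iff)
    qed
    finally show ?thesis .
  qed
  have 2: "measure (env G) (?L n) \<le> 1 - no_return k" for n
  proof -
    have "measure (env G) (?L n) \<le> measure (env G) (space (env G) - ?Z)"
    proof (rule E.finite_measure_mono_AE)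
      show "AE a in env G. a \<in> ?L n \<longrightarrow> a \<in> space (env G) - ?Z"
        using AE_recurring AE_hits
      proof eventually_elim
        fix a :: "int \<Rightarrow> nat \<Rightarrow> bool"
        assume "\<forall>x c. recurring c (a x)" and hits: "\<forall>k. \<exists>n. pos (walk a n) = int k"
        then have rec: "\<And>x. recurring True (a x)" by blast
        obtain T where T: "pos (walk a T) = int k" "site (int k) (walk a T) = []"
          using hits first_hit_exists by blast
        obtain j where j: "stp ?C (walk a n) = walk a j" "\<forall>i<j. ?C (walk a i)"
          using stp_walk[of n ?C a] by blast
        show "a \<in> ?L n \<longrightarrow> a \<in> space (env G) - ?Z"
          using crossings_pos_if_exit_left[OF rec T, of j] j by auto
      qed
    qed (rule sets.compl_sets[OF sets_crossings])
    also have "\<dots> = 1 - no_return k" unfolding no_return_def by (rule E.prob_compl[OF sets_crossings])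
    finally show ?thesis .
  qed
  have *: "real k * measure (env G) (?R n) \<le> ?S + 1 - no_return k" for n
    using 1[of n] 2[of n] by linarith
  have "?R n \<subseteq> ?R (Suc n)" for n by (auto simp: confined_def)
  then have inc: "incseq ?R" by (rule incseq_SucI)
  have lim: "(\<lambda>n. real k * measure (env G) (?R n)) \<longlonglongrightarrow> real k * measure (env G) (\<Union>n. ?R n)"
    by (intro tendsto_intros E.finite_Lim_measure_incseq inc) auto
  have "no_return k \<le> measure (env G) (\<Union>n. ?R n)"
    unfolding no_return_def
  proof (rule E.finite_measure_mono_AE)
    show "AE a in env G. a \<in> ?Z \<longrightarrow> a \<in> (\<Union>n. ?R n)"
      using AE_recurring AE_hits
    proof eventually_elim
      fix a :: "int \<Rightarrow> nat \<Rightarrow> bool"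
      assume "\<forall>x c. recurring c (a x)" and hits: "\<forall>k. \<exists>n. pos (walk a n) = int k"
      then have rec: "\<And>x. recurring True (a x)" by blast
      obtain T where T: "pos (walk a T) = int k" "site (int k) (walk a T) = []"
        using hits first_hit_exists by blast
      show "a \<in> ?Z \<longrightarrow> a \<in> (\<Union>n. ?R n)"
        using confined_if_crossings_zero[OF rec T] stp_walk_alive[of T ?C a] T(1) by (auto intro!: exI[of _ T])
    qed
  qed measurable
  then have "real k * no_return k \<le> real k * measure (env G) (\<Union>n. ?R n)" by (intro mult_left_mono) auto
  also have "\<dots> \<le> ?S + 1 - no_return k"
    by (rule LIMSEQ_le_const2[OF lim]) (use * in auto)
  finally show ?thesis by (simp add: algebra_simps)
qed

text \<open>If the first \<open>n + 1\<close> arrows all point right, \<open>stop b 0\<close> is 1,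
  while the arrow with index \<open>n + 1\<close> still carries drift \<open>?g > 0\<close>. This
  has positive probability.\<close>

lemma consumed_0_gap: "\<exists>\<eta>>0. consumed 0 + ennreal \<eta> \<le> total_drift"
proof -
  obtain n where n: "1 / 2 < G (replicate (Suc n) True)" using excited by blast
  let ?r = "replicate (Suc n) True"
  let ?g = "2 * G ?r - 1"
  have wt: "0 < wt G (replicate m True)" for m
  proof (induction m)
    case (Suc m)
    have "0 < G (replicate m True)" using G_ge[of "replicate m True"] by linarith
    then show ?case using Suc by simp
  qed simp
  have g: "0 < ?g" using n by simp
  have "consumed 0 + ennreal (wt G ?r * ?g)
      = (\<integral>\<^sup>+b. ennreal (drift G (pre b (stop b 0))) \<partial>law G) + ennreal ?g * emeasure (law G) {b. pre b (Suc n) = ?r}"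
    using wt[of "Suc n"] g by (subst emeasure_law_pre) (auto simp: G_nonneg G_le_1 consumed_def ennreal_mult'' mult.commute simp del: pre.simps replicate.simps wt.simps)
  also have "\<dots> = (\<integral>\<^sup>+b. ennreal (drift G (pre b (stop b 0))) \<partial>law G) + (\<integral>\<^sup>+b. ennreal ?g * indicator {b. pre b (Suc n) = ?r} b \<partial>law G)"
    using sets_pre[of "\<lambda>h. h = ?r" "Suc n"] by (subst nn_integral_cmult_indicator) (simp_all del: pre.simps replicate.simps)
  also have "\<dots> = (\<integral>\<^sup>+b. ennreal (drift G (pre b (stop b 0))) + ennreal ?g * indicator {b. pre b (Suc n) = ?r} b \<partial>law G)"
  proof (rule nn_integral_add[symmetric])
    have "{b. pre b (Suc n) = ?r} \<in> sets (law G)"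
      using sets_pre[of "\<lambda>h. h = ?r" "Suc n"] by (simp del: pre.simps replicate.simps)
    then show "(\<lambda>b. ennreal ?g * indicator {b. pre b (Suc n) = ?r} b) \<in> borel_measurable (law G)" by measurable
  qed (rule measurable_drift_stop)
  also have "\<dots> \<le> total_drift"
    unfolding total_drift_def
  proof (rule nn_integral_mono)
    fix b
    show "ennreal (drift G (pre b (stop b 0))) + ennreal ?g * indicator {b. pre b (Suc n) = ?r} b \<le> (SUP n. ennreal (drift G (pre b n)))"
    proof (cases "pre b (Suc n) = ?r")
      case False
      then show ?thesis by (auto intro: SUP_upper2)
    next
      case True
      have "b 0" using pre_nth[of 0 "Suc n" b] unfolding True by (simp del: replicate.simps)
      then have "stop b 0 = Suc 0" by (intro stop_eqI) auto
      then have "drift G (pre b (stop b 0)) + ?g \<le> drift G (pre b (Suc n)) + ?g"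
        using drift_pre_mono[of "Suc 0" "Suc n" b] by simp
      also have "\<dots> = drift G (pre b (Suc (Suc n)))" using True by simp
      finally have "ennreal (drift G (pre b (stop b 0)) + ?g) \<le> ennreal (drift G (pre b (Suc (Suc n))))"
        by (rule ennreal_leI)
      also have "\<dots> \<le> (SUP n. ennreal (drift G (pre b n)))" by (rule SUP_upper) simp
      finally show ?thesis using True g drift_nonneg by simp
    qed
  qed
  finally show ?thesis using wt[of "Suc n"] g by (intro exI[of _ "wt G ?r * ?g"]) (simp del: replicate.simps wt.simps)
qed

lemma no_return_LIMSEQ:
  assumes fin: "total_drift \<le> 1"
  shows "no_return \<longlonglongrightarrow> 0"
proof -
  have dec: "decseq no_return"
  proof (rule decseq_SucI)
    show "no_return (Suc m) \<le> no_return m" for m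
      unfolding no_return_def
    proof (rule E.finite_measure_mono_AE)
      show "AE a in env G. a \<in> {a. crossings a 0 (Suc m) = 0} \<longrightarrow> a \<in> {a. crossings a 0 m = 0}"
        using AE_crossings_mono
      proof eventually_elim
        fix a :: "int \<Rightarrow> nat \<Rightarrow> bool" assume "\<forall>x m m'. m \<le> m' \<longrightarrow> crossings a x m \<le> crossings a x m'"
        then have "crossings a 0 m \<le> crossings a 0 (Suc m)" by (simp del: crossings.simps)
        then show "a \<in> {a. crossings a 0 (Suc m) = 0} \<longrightarrow> a \<in> {a. crossings a 0 m = 0}"
          by (simp del: crossings.simps)
      qed
    qed (rule sets_crossings)
  qed
  have nn: "0 \<le> no_return m" "no_return m \<le> 1" for m by (auto simp: no_return_def)
  obtain c where c: "no_return \<longlonglongrightarrow> c" "\<And>m. c \<le> no_return m"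
    using decseq_convergent[OF dec, of 0] nn(1) by blast
  have "0 \<le> c" by (rule LIMSEQ_le_const[OF c(1)]) (use nn in auto)
  moreover have "\<not> 0 < c"
  proof
    assume c0: "0 < c"
    obtain \<eta> where \<eta>: "0 < \<eta>" "consumed 0 + ennreal \<eta> \<le> total_drift" using consumed_0_gap by blast
    have "\<eta> \<le> 1"
    proof -
      have "ennreal \<eta> \<le> 1" using \<eta>(2) fin by (meson add_increasing order_trans order_refl zero_le)
      then show ?thesis by (simp add: ennreal_le_1)
    qed
    have c1: "c \<le> 1" using c(2)[of 0] nn(2)[of 0] by linarith
    have chain_le: "enn2real (chain m consumed) \<le> 1 - c * \<eta>" for m
    proof -
      have le: "consumed w \<le> ennreal (1 - \<eta> * (if w = 0 then 1 else 0))" for w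
      proof (cases "w = 0")
        case True
        have "consumed 0 + ennreal \<eta> \<le> 1" using \<eta>(2) fin by (rule order_trans)
        then have "consumed 0 \<le> 1 - ennreal \<eta>" by (simp add: ennreal_le_minus_iff)
        then show ?thesis using True \<eta>(1) by (simp add: ennreal_minus ennreal_1[symmetric] del: ennreal_1)
      next
        case False
        then show ?thesis using consumed_le[of w] fin by (auto intro: order_trans)
      qed
      have "chain m consumed \<le> (\<integral>\<^sup>+a. ennreal (1 - \<eta> * indicator {a. crossings a 0 m = 0} a) \<partial>env G)"
        unfolding chain_eq[of _ _ 0] by (intro nn_integral_mono order_trans[OF le]) (simp add: indicator_def)
      also have "\<dots> = ennreal (\<integral>a. 1 - \<eta> * indicator {a. crossings a 0 m = 0} a \<partial>env G)"
        using \<eta>(1) \<open>\<eta> \<le> 1\<close> by (intro nn_integral_eq_integral) (auto simp: indicator_def intro!: E.integrable_const_bound[where B=1] AE_I2)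
      also have "(\<integral>a. 1 - \<eta> * indicator {a. crossings a 0 m = 0} a \<partial>env G) = 1 - \<eta> * no_return m"
      proof -
        have "integrable (env G) (indicat_real {a. crossings a 0 m = 0})"
          by (rule integrable_real_indicator[OF sets_crossings]) (simp add: E.emeasure_eq_measure)
        then show ?thesis
          using E.prob_space by (subst Bochner_Integration.integral_diff) (auto simp: no_return_def)
      qed
      finally have "chain m consumed \<le> ennreal (1 - \<eta> * no_return m)" .
      moreover have "\<eta> * no_return m \<le> 1 * 1" using \<eta>(1) \<open>\<eta> \<le> 1\<close> nn by (intro mult_mono) auto
      ultimately have "enn2real (chain m consumed) \<le> 1 - \<eta> * no_return m"
        by (simp add: enn2real_leI)
      moreover have "c * \<eta> \<le> \<eta> * no_return m" using c(2)[of m] \<eta>(1) by (simp add: mult.commute)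
      ultimately show ?thesis by linarith
    qed
    define \<delta> where "\<delta> = c * \<eta>"
    have \<delta>: "0 < \<delta>" "\<delta> \<le> 1" using c0 \<eta>(1) c1 \<open>\<eta> \<le> 1\<close> mult_mono[of c 1 \<eta> 1] by (auto simp: \<delta>_def)
    \<comment> \<open>The factor is close enough to 1 that
      \<open>(1 + \<delta> / 2) * (1 - \<delta>) \<le> 1 - \<delta> / 2\<close>, which leaves a
      linear gap in \<open>k\<close>.\<close>
    have "c < c * (1 + \<delta> / 2)" using c0 \<delta> by simp
    then obtain X where X: "\<And>x. X \<le> x \<Longrightarrow> no_return x < c * (1 + \<delta> / 2)"
      using order_tendstoD(2)[OF c(1)] unfolding eventually_sequentially by blast
    have bound: "real k * (c * \<delta> / 2) \<le> 1 + real X" if "X \<le> k" "0 < k" for k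
    proof -
      have "real (k + 1) * c \<le> real (k + 1) * no_return k" using c(2) by (intro mult_left_mono) auto
      also have "\<dots> \<le> 1 + (\<Sum>x<k. no_return x * enn2real (chain (k - Suc x) consumed))"
        by (rule no_return_le[OF that(2) fin])
      also have "(\<Sum>x<k. no_return x * enn2real (chain (k - Suc x) consumed)) \<le> (\<Sum>x<k. no_return x * (1 - \<delta>))"
        using chain_le nn by (intro sum_mono mult_left_mono) (auto simp: \<delta>_def)
      also have "\<dots> = (\<Sum>x<X. no_return x * (1 - \<delta>)) + (\<Sum>x=X..<k. no_return x * (1 - \<delta>))"
        using that(1) by (simp add: lessThan_atLeast0 sum.atLeastLessThan_concat)
      also have "(\<Sum>x<X. no_return x * (1 - \<delta>)) \<le> (\<Sum>x<X. 1)"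
        using nn \<delta> by (intro sum_mono mult_le_one) auto
      also have "(\<Sum>x=X..<k. no_return x * (1 - \<delta>)) \<le> (\<Sum>x=X..<k. c * (1 + \<delta> / 2) * (1 - \<delta>))"
        using X \<delta> by (intro sum_mono mult_right_mono) (auto intro: less_imp_le)
      also have "\<dots> = real (k - X) * (c * (1 + \<delta> / 2) * (1 - \<delta>))" by simp
      also have "\<dots> \<le> real k * (c * (1 - \<delta> / 2))"
      proof (rule mult_mono)
        have "(1 + \<delta> / 2) * (1 - \<delta>) = 1 - \<delta> / 2 - \<delta>\<^sup>2 / 2" by (simp add: field_simps power2_eq_square)
        also have "\<dots> \<le> 1 - \<delta> / 2" by simp
        finally show "c * (1 + \<delta> / 2) * (1 - \<delta>) \<le> c * (1 - \<delta> / 2)" using c0 by (simp add: mult.assoc)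
      qed (use c0 \<delta> in auto)
      finally show ?thesis using c0 by (simp add: algebra_simps)
    qed
    have "0 < c * \<delta> / 2" using c0 \<delta> by simp
    then obtain k :: nat where k: "1 + real X < real k * (c * \<delta> / 2)" using reals_Archimedean3 by blast
    have "1 + real X < real (max k (Suc X)) * (c * \<delta> / 2)"
    proof -
      have "real k * (c * \<delta> / 2) \<le> real (max k (Suc X)) * (c * \<delta> / 2)"
        using \<open>0 < c * \<delta> / 2\<close> by (intro mult_right_mono) auto
      with k show ?thesis by linarith
    qed
    moreover have "X \<le> max k (Suc X)" "0 < max k (Suc X)" by auto
    ultimately show False using bound[of "max k (Suc X)"] by linarith
  qed
  ultimately show ?thesis using c(1) by (simp add: antisym_conv1 not_less)
qed

text \<open>From a state \<open>w \<le> r\<close> the chain jumps to \<open>0\<close> when the next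
  \<open>w + 1\<close> arrows all point right, with probability at least
  \<open>(1 / 2) ^ Suc r\<close>. As state \<open>0\<close> becomes improbable, so does every
  bounded set of states.\<close>

lemma AE_unbounded:
  assumes fin: "total_drift \<le> 1"
  shows "AE a in env G. a \<in> unbounded 0"
proof -
  have le: "measure (env G) {a. \<not> r < crossings a 0 m} \<le> 2 ^ Suc r * no_return (Suc m)" for r m
  proof -
    have lefts0: "ennreal ((1 / 2) ^ Suc r) * indicator {..r} w \<le> (\<integral>\<^sup>+b. indicator {0} (lefts b w) \<partial>law G)" for w
    proof (cases "w \<le> r")
      case True
      let ?r = "replicate (Suc w) True"
      have "(1 / 2) ^ m \<le> wt G (replicate m True)" for m
      proof (induction m)
        case (Suc m)
        have "(1 / 2) ^ m * (1 / 2) \<le> wt G (replicate m True) * G (replicate m True)"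
          using Suc G_ge[of "replicate m True"] by (intro mult_mono) (auto simp: wt_nonneg G_nonneg G_le_1)
        then show ?case by (simp add: mult.commute)
      qed simp
      moreover have "(1 / 2) ^ Suc r \<le> (1 / 2 :: real) ^ Suc w" using True by (intro power_decreasing) auto
      ultimately have "(1 / 2) ^ Suc r \<le> wt G ?r" by (rule order_trans[rotated])
      then have "ennreal ((1 / 2) ^ Suc r) \<le> emeasure (law G) {b. pre b (Suc w) = ?r}"
        by (subst emeasure_law_pre) (auto simp: G_nonneg G_le_1 simp del: replicate.simps wt.simps power_Suc intro: ennreal_leI)
      also have "\<dots> = (\<integral>\<^sup>+b. indicator {b. pre b (Suc w) = ?r} b \<partial>law G)"
        using sets_pre[of "\<lambda>h. h = ?r" "Suc w"] by (simp del: pre.simps replicate.simps)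
      also have "\<dots> \<le> (\<integral>\<^sup>+b. indicator {0} (lefts b w) \<partial>law G)"
      proof (rule nn_integral_mono)
        fix b
        show "indicator {b. pre b (Suc w) = ?r} b \<le> (indicator {0} (lefts b w) :: ennreal)"
        proof (cases "pre b (Suc w) = ?r")
          case True
          then have "b w" "pre b w = replicate w True" by auto
          moreover have cr: "count_list (replicate w x) y = (if x = y then w else 0)" for x y :: bool
            by (induction w) auto
          ultimately have "stop b w = Suc w" by (intro stop_eqI) auto
          then have "lefts b w = 0" using \<open>b w\<close> \<open>pre b w = _\<close> cr by (simp add: lefts_def)
          then show ?thesis by (simp add: indicator_def)
        qed simp
      qed
      finally show ?thesis using True by simp
    qed simp
    have "ennreal ((1 / 2) ^ Suc r * measure (env G) {a. \<not> r < crossings a 0 m})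
       = ennreal ((1 / 2) ^ Suc r) * emeasure (env G) {a. \<not> r < crossings a 0 m}"
      by (simp add: E.emeasure_eq_measure ennreal_mult del: power_Suc)
    also have "\<dots> = (\<integral>\<^sup>+a. ennreal ((1 / 2) ^ Suc r) * indicator {a. \<not> r < crossings a 0 m} a \<partial>env G)"
      by (rule nn_integral_cmult_indicator[symmetric]) (rule sets_crossings)
    also have "\<dots> \<le> (\<integral>\<^sup>+a. (\<integral>\<^sup>+b. indicator {0} (lefts b (crossings a 0 m)) \<partial>law G) \<partial>env G)"
      using lefts0 by (intro nn_integral_mono) (auto simp: indicator_def not_less simp del: power_Suc)
    also have "\<dots> = chain (Suc m) (indicator {0})" by (simp add: chain_eq[of m _ 0])
    also have "\<dots> = (\<integral>\<^sup>+a. indicator {a. crossings a 0 (Suc m) = 0} a \<partial>env G)"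
      unfolding chain_eq[of "Suc m" _ 0] by (intro nn_integral_cong) (auto simp: indicator_def)
    also have "\<dots> = ennreal (no_return (Suc m))"
      using sets_crossings[of "\<lambda>w. w = 0" 0 "Suc m"]
      by (simp add: no_return_def E.emeasure_eq_measure del: crossings.simps)
    finally have "(1 / 2) ^ Suc r * measure (env G) {a. \<not> r < crossings a 0 m} \<le> no_return (Suc m)"
      by (subst (asm) ennreal_le_iff) (auto simp: no_return_def)
    then show ?thesis by (simp add: field_simps)
  qed
  have one: "measure (env G) {a. \<exists>m. r < crossings a 0 m} = 1" for r
  proof -
    have "(\<lambda>m. 2 ^ Suc r * no_return (Suc m)) \<longlonglongrightarrow> 2 ^ Suc r * 0"
      by (intro tendsto_mult tendsto_const LIMSEQ_Suc[OF no_return_LIMSEQ[OF fin]])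
    then have up: "(\<lambda>m. 2 ^ Suc r * no_return (Suc m)) \<longlonglongrightarrow> 0" by simp
    have lim0: "(\<lambda>m. measure (env G) {a. \<not> r < crossings a 0 m}) \<longlonglongrightarrow> 0"
      by (rule tendsto_sandwich[OF _ _ tendsto_const up]) (intro always_eventually allI measure_nonneg le)+
    have eq: "measure (env G) {a. r < crossings a 0 m} = 1 - measure (env G) {a. \<not> r < crossings a 0 m}" for m
      using E.prob_compl[OF sets_crossings[of "\<lambda>w. \<not> r < w" 0 m]] by (simp add: Compl_eq_Diff_UNIV[symmetric] Collect_neg_eq[symmetric])
    have "(\<lambda>m. measure (env G) {a. r < crossings a 0 m}) \<longlonglongrightarrow> 1 - 0"
      unfolding eq by (intro tendsto_intros lim0)
    moreover have "(\<lambda>m. measure (env G) {a. r < crossings a 0 m}) \<longlonglongrightarrow> measure (env G) {a. \<exists>m. r < crossings a 0 m}"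
      using measure_crossings_LIMSEQ[of UNIV r 0] sets.top[of "env G"] by simp
    ultimately show ?thesis using LIMSEQ_unique by fastforce
  qed
  have "(\<lambda>r. measure (env G) {a. \<exists>m. r < crossings a 0 m}) \<longlonglongrightarrow> measure (env G) (unbounded 0)"
    using measure_unbounded_LIMSEQ[of UNIV 0] sets.top[of "env G"] by simp
  then have "measure (env G) (unbounded 0) = 1" unfolding one by (simp add: LIMSEQ_const_iff)
  then show ?thesis by (rule E.AE_prob_1)
qed

section \<open>Almost sure recurrence and transience of the walk\<close>

theorem recurrent_if_total_drift_le_1:
  assumes "total_drift \<le> 1"
  shows "AE u in unif_seq. recurrent (\<lambda>n. pos (hist W u n))"
proof -
  have "AE a in env G. recurrent (\<lambda>n. pos (pre (steps a) n))"
    using AE_recurring AE_hits AE_unbounded[OF assms]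
  proof eventually_elim
    fix a assume "\<forall>x c. recurring c (a x)" "\<forall>k. \<exists>n. pos (walk a n) = int k" "a \<in> unbounded 0"
    moreover from this have "\<exists>m. r \<le> crossings a 0 m" for r
      unfolding unbounded_def by (blast intro: less_imp_le)
    ultimately show "recurrent (\<lambda>n. pos (pre (steps a) n))"
      unfolding pre_steps by (intro recurrent_if_crossings_unbounded) auto
  qed
  moreover have "{b. recurrent (\<lambda>n. pos (pre b n))} \<in> sets bool_seq"
  proof -
    have [measurable]: "Measurable.pred bool_seq (\<lambda>b. pos (pre b n) = x)" for n x
      by (rule measurable_compose[OF measurable_pre]) simp
    have "{b. recurrent (\<lambda>n. pos (pre b n))} = {b \<in> space bool_seq. \<forall>x m. \<exists>n\<ge>m. pos (pre b n) = x}"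
      by (auto simp: recurrent_def infinite_nat_iff_unbounded_le)
    also have "\<dots> \<in> sets bool_seq" by measurable
    finally show ?thesis .
  qed
  ultimately show ?thesis
    using AE_grrw_law[OF G_nonneg G_le_1, of "\<lambda>b. recurrent (\<lambda>n. pos (pre b n))"] by (simp add: pre_hist)
qed

theorem transient_if_total_drift_gt_1:
  assumes "1 < total_drift"
  shows "AE u in unif_seq. filterlim (\<lambda>n. pos (hist W u n)) at_top sequentially"
proof -
  have "AE a in env G. filterlim (\<lambda>n. pos (pre (steps a) n)) at_top sequentially"
    using AE_recurring AE_hits AE_bounded[OF assms]
  proof eventually_elim
    fix a assume "\<forall>x c. recurring c (a x)" "\<forall>k. \<exists>n. pos (walk a n) = int k" "a \<notin> unbounded 0"
    moreover from this obtain r where "\<And>m. crossings a 0 m \<le> r" by (auto simp: unbounded_def not_less)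
    ultimately show "filterlim (\<lambda>n. pos (pre (steps a) n)) at_top sequentially"
      unfolding pre_steps by (intro transient_if_crossings_bounded) auto
  qed
  moreover have "{b. filterlim (\<lambda>n. pos (pre b n)) at_top sequentially} \<in> sets bool_seq"
  proof -
    have [measurable]: "Measurable.pred bool_seq (\<lambda>b. x \<le> pos (pre b n))" for n x
      by (rule measurable_compose[OF measurable_pre]) simp
    have "{b. filterlim (\<lambda>n. pos (pre b n)) at_top sequentially} = {b \<in> space bool_seq. \<forall>x. \<exists>m. \<forall>n\<ge>m. x \<le> pos (pre b n)}"
      by (auto simp: filterlim_at_top eventually_sequentially)
    also have "\<dots> \<in> sets bool_seq" by measurable
    finally show ?thesis .
  qed
  ultimately show ?thesis
    using AE_grrw_law[OF G_nonneg G_le_1, of "\<lambda>b. filterlim (\<lambda>n. pos (pre b n)) at_top sequentially"] by (simp add: pre_hist)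
qed

end

section \<open>The reinforcement function\<close>

text \<open>At the kink the difference quotient is bounded by a positive power of the increment; on
  either side the function is a polynomial.\<close>

lemma has_real_derivative_pos_part_power:
  fixes c x :: real
  shows "((\<lambda>x. max 0 (x - c) ^ (n + 2)) has_real_derivative real (n + 2) * max 0 (x - c) ^ (n + 1)) (at x)"
proof -
  consider "x < c" | "x = c" | "c < x" by linarith
  then show ?thesis
  proof cases
    case 1
    have "((\<lambda>x. 0) has_real_derivative 0) (at x)" by simp
    then have "((\<lambda>x. max 0 (x - c) ^ (n + 2)) has_real_derivative 0) (at x)"
      by (rule has_field_derivative_transform_within_open[where S="{..<c}"]) (use 1 in \<open>auto simp: max_def\<close>)
    then show ?thesis using 1 by (simp add: max_def)
  next
    case 2
    have "((\<lambda>h::real. max 0 h ^ (n + 2) / h) \<longlongrightarrow> 0) (at 0)"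
    proof (rule Lim_null_comparison)
      show "\<forall>\<^sub>F h::real in at 0. norm (max 0 h ^ (n + 2) / h) \<le> \<bar>h\<bar> ^ (n + 1)"
        by (rule always_eventually) (auto simp: max_def mult_nonpos_nonneg)
      have "((\<lambda>h::real. \<bar>h\<bar> ^ (n + 1)) \<longlongrightarrow> \<bar>0\<bar> ^ (n + 1)) (at 0)" by (intro tendsto_intros)
      then show "((\<lambda>h::real. \<bar>h\<bar> ^ (n + 1)) \<longlongrightarrow> 0) (at 0)" by simp
    qed
    then show ?thesis using 2 by (simp add: DERIV_def)
  next
    case 3
    have "((\<lambda>x. (x - c) ^ (n + 2)) has_real_derivative real (n + 2) * (x - c) ^ (n + 1)) (at x)"
      using DERIV_power[OF DERIV_diff[OF DERIV_ident DERIV_const[of c]], where n="n + 2" and x=x and s=UNIV] by simp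
    then have "((\<lambda>x. max 0 (x - c) ^ (n + 2)) has_real_derivative real (n + 2) * (x - c) ^ (n + 1)) (at x)"
      by (rule has_field_derivative_transform_within_open[where S="{c<..}"]) (use 3 in \<open>auto simp: max_def\<close>)
    then show ?thesis using 3 by (simp add: max_def)
  qed
qed

text \<open>Any value above \<open>3/4\<close> at \<open>1\<close> makes the total drift exceed \<open>1\<close> as \<open>l\<close> tends to \<open>0\<close>; here it is \<open>4/5\<close>, so
  that \<open>reinf x < x\<close> wherever \<open>reinf\<close> is not constant.\<close>
definition reinf :: "real \<Rightarrow> real" where
  "reinf x = 1 / 2 + 3000 * max 0 (x - 9 / 10) ^ 4"

lemma reinf_deriv: "(reinf has_real_derivative 12000 * max 0 (x - 9 / 10) ^ 3) (at x)"
  unfolding reinf_def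
  using DERIV_add[OF DERIV_const[of "1 / 2"]
      DERIV_cmult[OF has_real_derivative_pos_part_power[where n=2 and c="9/10" and x=x], of 3000]]
  by simp

lemma C3_reinf: "C3_on_unit reinf"
  unfolding C3_on_unit_def
proof (intro exI conjI ballI)
  let ?p = "\<lambda>x::real. max 0 (x - 9 / 10)"
  fix x :: real
  show "(reinf has_real_derivative 12000 * ?p x ^ 3) (at x within {0..1})"
    by (rule has_field_derivative_at_within[OF reinf_deriv])
  have "((\<lambda>x. 12000 * ?p x ^ 3) has_real_derivative 36000 * ?p x ^ 2) (at x)"
    using DERIV_cmult[OF has_real_derivative_pos_part_power[where n=1 and c="9/10" and x=x], of 12000]
    by (simp add: numeral_3_eq_3 numeral_2_eq_2)
  then show "((\<lambda>x. 12000 * ?p x ^ 3) has_real_derivative 36000 * ?p x ^ 2) (at x within {0..1})"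
    by (rule has_field_derivative_at_within)
  have "((\<lambda>x. 36000 * ?p x ^ 2) has_real_derivative 72000 * ?p x) (at x)"
    using DERIV_cmult[OF has_real_derivative_pos_part_power[where n=0 and c="9/10" and x=x], of 36000]
    by (simp add: power2_eq_square)
  then show "((\<lambda>x. 36000 * ?p x ^ 2) has_real_derivative 72000 * ?p x) (at x within {0..1})"
    by (rule has_field_derivative_at_within)
  show "continuous_on {0..1} (\<lambda>x. 72000 * ?p x)" by (intro continuous_intros)
qed

lemma reinf_ge: "1 / 2 \<le> reinf x"
  by (simp add: reinf_def)

lemma reinf_flat: "x \<le> 9 / 10 \<Longrightarrow> reinf x = 1 / 2"
  by (simp add: reinf_def max_def)

lemma reinf_gt: "9 / 10 < x \<Longrightarrow> 1 / 2 < reinf x"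
  by (simp add: reinf_def max_def)

lemma reinf_mono: "x \<le> y \<Longrightarrow> reinf x \<le> reinf y"
  unfolding reinf_def by (intro add_left_mono mult_left_mono power_mono) auto

lemma reinf_le: "x \<le> 1 \<Longrightarrow> reinf x \<le> 4 / 5"
  using reinf_mono[of x 1] by (simp add: reinf_def power_divide)

lemma continuous_on_reinf [continuous_intros]:
  assumes "continuous_on A f"
  shows "continuous_on A (\<lambda>x. reinf (f x))"
  unfolding reinf_def by (intro continuous_intros assms)

text \<open>Up to \<open>9 / 10\<close> the function is constant; beyond, its values are at most
  \<open>4 / 5\<close>, below the argument.\<close>

lemma reinf_fixed_point: "is_fixed_point reinf p \<longleftrightarrow> p = 1 / 2"
proof -
  have "p = 1 / 2" if "is_fixed_point reinf p"
    using that reinf_flat[of p] reinf_le[of p] by (cases "p \<le> 9 / 10") (auto simp: is_fixed_point_def)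
  moreover have "is_fixed_point reinf (1 / 2)"
    by (simp add: is_fixed_point_def reinf_flat)
  ultimately show ?thesis by blast
qed

section \<open>The urn at one site and its identification with the reinforced walk\<close>

definition urn :: "real \<Rightarrow> bool list \<Rightarrow> real" where
  "urn l h = reinf ((1 / 2 * l + real (count_list h True)) / (l + real (length h)))"

lemma urn_arg_le_1:
  assumes "0 < l"
  shows "(1 / 2 * l + real (count_list h True)) / (l + real (length h)) \<le> 1"
proof -
  have "real (count_list h True) \<le> real (length h)" by (simp add: count_le_length)
  then show ?thesis using assms by (simp add: divide_le_eq_1)
qed

lemma urn_ge: "1 / 2 \<le> urn l h"
  unfolding urn_def by (rule reinf_ge)

lemma urn_le: "0 < l \<Longrightarrow> urn l h \<le> 4 / 5"
  unfolding urn_def by (intro reinf_le urn_arg_le_1)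

lemma count_list_replicate: "count_list (replicate n x) x = n"
  by (induction n) auto

lemma site_law_urn:
  assumes "0 < l"
  shows "site_law (urn l) (4 / 5)"
proof
  show "\<exists>n. 1 / 2 < urn l (replicate (Suc n) True)"
  proof -
    \<comment> \<open>After \<open>s\<close> right arrows the proportion exceeds
      \<open>9 / 10\<close> exactly when \<open>s > 4 * l\<close>.\<close>
    obtain n :: nat where "4 * l < real n" using reals_Archimedean2 by blast
    then have "9 / 10 < (1 / 2 * l + real (Suc n)) / (l + real (Suc n))"
      using assms by (simp add: field_simps)
    then have "1 / 2 < urn l (replicate (Suc n) True)"
      unfolding urn_def count_list_replicate length_replicate by (rule reinf_gt)
    then show ?thesis ..
  qed
  show "1 / 2 \<le> urn l h" for h by (rule urn_ge)
  show "urn l h \<le> 4 / 5" for h by (rule urn_le[OF assms])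
qed simp

text \<open>Both walks compare the same uniform variable with the same threshold, so they agree
  pathwise. The bound \<open>k \<le> n\<close> is there because \<open>walk_hist\<close> is
  meaningful only up to time \<open>n\<close>.\<close>

lemma walk_hist_eq:
  "k \<le> n \<Longrightarrow> walk_hist reinf (\<lambda>_. 1 / 2) (\<lambda>_. l) u n k = pos (hist (walk_predictor (urn l)) u k)"
proof (induction n arbitrary: k)
  case (Suc n)
  let ?W = "walk_predictor (urn l)"
  let ?X = "walk_hist reinf (\<lambda>_. 1 / 2) (\<lambda>_. l) u n"
  let ?b = "\<lambda>n. u n < ?W (hist ?W u n)"
  let ?h = "hist ?W u n"
  have X: "?X k = pos (pre ?b k)" if "k \<le> n" for k using Suc.IH[OF that] by (simp add: pre_hist)
  have h: "?h = pre ?b n" by (simp add: pre_hist)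
  have "{k. k < n \<and> ?X k = x} = {k. k < n \<and> pos (pre ?b k) = x}" for x
    using X by auto
  then have len: "card {k. k < n \<and> ?X k = x} = length (site x ?h)" for x
    unfolding h length_site_pre by simp
  have "{k. k < n \<and> ?X k = x \<and> ?X (Suc k) = x + 1} = {k. k < n \<and> pos (pre ?b k) = x \<and> pos (pre ?b (Suc k)) = x + 1}" for x
    using X by (auto simp del: pre.simps)
  then have cnt: "card {k. k < n \<and> ?X k = x \<and> ?X (Suc k) = x + 1} = count_list (site x ?h) True" for x
    unfolding h count_site_pre by simp
  have "reinf (alpha_tilde (\<lambda>_. 1 / 2) (\<lambda>_. l) ?X n (?X n)) = ?W ?h"
    unfolding alpha_tilde_def len cnt using X[of n] by (simp add: walk_predictor_def urn_def h)
  then show ?case using Suc X[of n] by (cases "k = Suc n") (auto simp: Let_def h)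
qed simp

lemma grrw_eq: "grrw reinf (\<lambda>_. 1 / 2) (\<lambda>_. l) u n = pos (hist (walk_predictor (urn l)) u n)"
  by (simp add: grrw_def walk_hist_eq)

section \<open>Dependence of the mean drift on the initial weight\<close>

definition mean_drift :: "real \<Rightarrow> nat \<Rightarrow> real" where
  "mean_drift l n = expect (urn l) n (drift (urn l))"

lemma total_drift_le_1_iff:
  assumes "0 < l"
  shows "site_law.total_drift (urn l) \<le> 1 \<longleftrightarrow> (\<forall>n. mean_drift l n \<le> 1)"
proof -
  interpret site_law "urn l" "4 / 5" by (rule site_law_urn[OF assms])
  show ?thesis unfolding total_drift_eq mean_drift_def by (simp add: SUP_le_iff ennreal_le_1)
qed

lemma mean_drift_Suc: "mean_drift l (Suc n) = mean_drift l n + expect (urn l) n (\<lambda>h. 2 * urn l h - 1)"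
  unfolding mean_drift_def expect_Suc by (simp add: expect_add[symmetric] algebra_simps)

lemma mean_drift_0 [simp]: "mean_drift l 0 = 0"
  by (simp add: mean_drift_def)

lemma mean_drift_eq_sum: "mean_drift l n = (\<Sum>m<n. expect (urn l) m (\<lambda>h. 2 * urn l h - 1))"
  by (induction n) (auto simp: mean_drift_Suc)

lemma continuous_on_mean_drift: "continuous_on {0<..} (\<lambda>l. mean_drift l n)"
proof -
  have urn: "continuous_on {0<..} (\<lambda>l. urn l h)" for h
    unfolding urn_def by (intro continuous_intros) (auto simp: add_pos_nonneg less_imp_neq[symmetric])
  have wt: "continuous_on {0<..} (\<lambda>l. wt (urn l) h)" for h
  proof (induction h)
    case (Cons c h)
    then show ?case by (cases c) (auto intro!: continuous_intros urn)
  qed simp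
  have drift: "continuous_on {0<..} (\<lambda>l. drift (urn l) h)" for h
    by (induction h) (auto intro!: continuous_intros urn)
  show ?thesis unfolding mean_drift_def expect_def by (intro continuous_intros wt drift)
qed

text \<open>On the flat part \<open>reinf\<close> takes its minimum. Elsewhere more than half of the
  arrows point right, so a larger initial weight at \<open>1 / 2\<close> lowers the
  proportion.\<close>

lemma urn_antimono:
  assumes l: "0 < l" "l \<le> l'" and len: "length h = length h'" and c: "count_list h' True \<le> count_list h True"
  shows "urn l' h' \<le> urn l h"
proof -
  define n r r' where "n = real (length h)" and "r = real (count_list h True)" and "r' = real (count_list h' True)"
  have r: "r' \<le> r" "0 \<le> r'" "0 \<le> n" using c by (auto simp: r_def r'_def n_def)
  let ?x = "(1 / 2 * l + r) / (l + n)" and ?x' = "(1 / 2 * l' + r') / (l' + n)"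
  have "reinf ?x' \<le> reinf ?x"
  proof (cases "?x' \<le> 9 / 10")
    case True
    then show ?thesis by (simp only: reinf_flat reinf_ge)
  next
    case False
    then have "n / 2 \<le> r'" using l r by (simp add: field_simps)
    then have "n / 2 \<le> r" using r by linarith
    then have "0 \<le> (r - n / 2) * (l' - l)" using l by (intro mult_nonneg_nonneg) auto
    then have "(1 / 2 * l' + r) * (l + n) \<le> (1 / 2 * l + r) * (l' + n)" by (simp add: field_simps)
    moreover have "(1 / 2 * l' + r') * (l + n) \<le> (1 / 2 * l' + r) * (l + n)"
      using l r by (intro mult_right_mono) auto
    ultimately have "(1 / 2 * l' + r') * (l + n) \<le> (1 / 2 * l + r) * (l' + n)" by linarith
    then have "?x' \<le> ?x" using l r by (simp add: divide_le_eq pos_le_divide_eq frac_le_eq field_simps)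
    then show ?thesis by (rule reinf_mono)
  qed
  then show ?thesis by (simp add: urn_def n_def r_def r'_def len)
qed

lemma nn_integral_hist:
  assumes G: "\<And>h. 0 \<le> G h" "\<And>h. G h \<le> 1" and \<phi>: "\<And>h. 0 \<le> \<phi> h"
  shows "(\<integral>\<^sup>+u. ennreal (\<phi> (hist G u n)) \<partial>unif_seq) = ennreal (expect G n \<phi>)"
proof -
  have [measurable]: "(\<lambda>b. ennreal (\<phi> (pre b n))) \<in> borel_measurable bool_seq"
    by (rule measurable_compose[OF measurable_pre]) simp
  have "(\<integral>\<^sup>+u. ennreal (\<phi> (hist G u n)) \<partial>unif_seq) = (\<integral>\<^sup>+b. ennreal (\<phi> (pre b n)) \<partial>law G)"
    unfolding law_def by (subst nn_integral_distr) (auto simp: pre_hist)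
  also have "\<dots> = ennreal (expect G n \<phi>)" by (rule nn_integral_law_pre[OF G \<phi>])
  finally show ?thesis .
qed

text \<open>Both urns use the same uniform variables; by \<open>urn_antimono\<close> the one with
  smaller weight always has at least as many right arrows and at least as much drift.\<close>

lemma mean_drift_antimono:
  assumes l: "0 < l" "l \<le> l'"
  shows "mean_drift l' n \<le> mean_drift l n"
proof -
  interpret L: site_law "urn l" "4 / 5" using l by (intro site_law_urn) auto
  interpret L': site_law "urn l'" "4 / 5" using l by (intro site_law_urn) auto
  have coupling: "count_list (hist (urn l') u n) True \<le> count_list (hist (urn l) u n) True
      \<and> drift (urn l') (hist (urn l') u n) \<le> drift (urn l) (hist (urn l) u n)" for u
  proof (induction n)
    case (Suc n)
    have "urn l' (hist (urn l') u n) \<le> urn l (hist (urn l) u n)"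
      using Suc by (intro urn_antimono[OF l]) auto
    then show ?case using Suc by auto
  qed simp
  have "ennreal (mean_drift l' n) = (\<integral>\<^sup>+u. ennreal (drift (urn l') (hist (urn l') u n)) \<partial>unif_seq)"
    unfolding mean_drift_def
    by (rule nn_integral_hist[symmetric, OF L'.G_nonneg L'.G_le_1 L'.drift_nonneg])
  also have "\<dots> \<le> (\<integral>\<^sup>+u. ennreal (drift (urn l) (hist (urn l) u n)) \<partial>unif_seq)"
    using coupling by (intro nn_integral_mono ennreal_leI) auto
  also have "\<dots> = ennreal (mean_drift l n)"
    unfolding mean_drift_def by (rule nn_integral_hist[OF L.G_nonneg L.G_le_1 L.drift_nonneg])
  finally have "ennreal (mean_drift l' n) \<le> ennreal (mean_drift l n)" .
  moreover have "0 \<le> mean_drift l n"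
    unfolding mean_drift_def
    using expect_mono[OF L.G_nonneg L.G_le_1, of n "\<lambda>_. 0" "drift (urn l)"] L.drift_nonneg by simp
  ultimately show ?thesis by (simp add: ennreal_le_iff)
qed

lemma mean_drift_le_1_eventually: "\<exists>l>0. \<forall>n. mean_drift l n \<le> 1"
proof -
  \<comment> \<open>Chernoff bound with weight \<open>2\<close> per right arrow; it works because \<open>9/5 < 2 powr (9/10)\<close>.\<close>
  define \<kappa> where "\<kappa> = (2::real) powr (9 / 10)"
  \<comment> \<open>\<open>\<kappa> ^ 10 = 2 ^ 9\<close> turns the comparison into one of rational
    numbers.\<close>
  have "(9 / 5) ^ 10 < \<kappa> ^ 10"
    unfolding \<kappa>_def by (simp add: powr_power power_divide)
  then have \<kappa>: "9 / 5 < \<kappa>" by (rule power_less_imp_less_base) (simp add: \<kappa>_def)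
  define \<rho> where "\<rho> = 9 / 5 / \<kappa>"
  have \<rho>: "0 \<le> \<rho>" "\<rho> < 1" using \<kappa> by (auto simp: \<rho>_def)
  have "summable (\<lambda>m. \<rho> ^ m)" using \<rho> by (intro summable_geometric) auto
  then obtain N where N: "\<And>m n. N \<le> m \<Longrightarrow> norm (sum ((^) \<rho>) {m..<n}) < 1"
    unfolding summable_Cauchy by (metis zero_less_one)
  \<comment> \<open>Drift at index \<open>m\<close> requires \<open>m > 4 * l\<close>, hence
    \<open>m \<ge> N\<close>, so only a tail of the geometric series remains.\<close>
  define l where "l = real (Suc N)"
  have l: "0 < l" by (simp add: l_def)
  interpret site_law "urn l" "4 / 5" by (rule site_law_urn[OF l])
  \<comment> \<open>One more arrow multiplies the mean by at most \<open>9 / 5\<close>, since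
    \<open>2 * G h + (1 - G h) = 1 + G h\<close>.\<close>
  have mgf: "expect (urn l) m (\<lambda>h. 2 ^ count_list h True) \<le> (9 / 5) ^ m" for m
  proof (induction m)
    case (Suc m)
    have "expect (urn l) (Suc m) (\<lambda>h. 2 ^ count_list h True) \<le> expect (urn l) m (\<lambda>h. 9 / 5 * 2 ^ count_list h True)"
      unfolding expect_Suc
    proof (rule expect_mono[OF G_nonneg G_le_1])
      fix h
      have "urn l h * 2 ^ count_list (True # h) True + (1 - urn l h) * 2 ^ count_list (False # h) True
          = (1 + urn l h) * 2 ^ count_list h True" by (simp add: algebra_simps)
      also have "\<dots> \<le> 9 / 5 * 2 ^ count_list h True" using urn_le[OF l, of h] by (intro mult_right_mono) auto
      finally show "urn l h * 2 ^ count_list (True # h) True + (1 - urn l h) * 2 ^ count_list (False # h) True \<le> \<dots>" .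
    qed
    also have "\<dots> \<le> 9 / 5 * (9 / 5) ^ m" unfolding expect_cmult using Suc by simp
    finally show ?case by simp
  qed simp
  have summand: "expect (urn l) m (\<lambda>h. 2 * urn l h - 1) \<le> (if N \<le> m then \<rho> ^ m else 0)" for m
  proof -
    have bound: "2 * urn l h - 1 \<le> (if N \<le> m then (1 / \<kappa>) ^ m * 2 ^ count_list h True else 0)" if len: "length h = m" for h
    proof (cases "(1 / 2 * l + real (count_list h True)) / (l + real m) \<le> 9 / 10")
      case True
      then have "urn l h = 1 / 2" unfolding urn_def len by (rule reinf_flat)
      then have "2 * urn l h - 1 = 0" by simp
      moreover have "0 \<le> (if N \<le> m then (1 / \<kappa>) ^ m * 2 ^ count_list h True else 0)" using \<kappa> by simp
      ultimately show ?thesis by (rule ord_eq_le_trans)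
    next
      case False
      then have gt: "9 / 10 * real m + 4 / 10 * l < real (count_list h True)" using l by (simp add: field_simps)
      moreover have "real (count_list h True) \<le> real m" using len count_le_length[of h True] by simp
      ultimately have "4 * l < real m" by linarith
      then have "N \<le> m" by (simp add: l_def)
      have "\<kappa> ^ m = 2 powr (9 / 10 * real m)" unfolding \<kappa>_def by (simp add: powr_power mult.commute)
      also have "\<dots> \<le> 2 powr real (count_list h True)" using gt l by (intro powr_mono) auto
      also have "\<dots> = 2 ^ count_list h True" by (simp add: powr_realpow)
      finally have "1 \<le> (1 / \<kappa>) ^ m * 2 ^ count_list h True" using \<kappa> by (simp add: power_one_over field_simps)
      moreover have "2 * urn l h - 1 \<le> 1" using urn_le[OF l, of h] by linarith
      ultimately show ?thesis using \<open>N \<le> m\<close> by simp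
    qed
    have "expect (urn l) m (\<lambda>h. 2 * urn l h - 1) \<le> expect (urn l) m (\<lambda>h. if N \<le> m then (1 / \<kappa>) ^ m * 2 ^ count_list h True else 0)"
      by (rule expect_mono[OF G_nonneg G_le_1 bound])
    also have "\<dots> \<le> (if N \<le> m then \<rho> ^ m else 0)"
    proof (cases "N \<le> m")
      case True
      have "(1 / \<kappa>) ^ m * expect (urn l) m (\<lambda>h. 2 ^ count_list h True) \<le> (1 / \<kappa>) ^ m * (9 / 5) ^ m"
        using \<kappa> by (intro mult_left_mono mgf) auto
      also have "\<dots> = \<rho> ^ m" by (simp add: \<rho>_def power_mult_distrib[symmetric] mult.commute)
      finally show ?thesis using True by (simp add: expect_cmult)
    qed simp
    finally show ?thesis .
  qed
  have "mean_drift l n \<le> 1" for n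
  proof -
    have "mean_drift l n \<le> (\<Sum>m<n. if N \<le> m then \<rho> ^ m else 0)"
      unfolding mean_drift_eq_sum by (intro sum_mono summand)
    also have "\<dots> = sum ((^) \<rho>) {N..<n}"
      by (rule sum.mono_neutral_cong_right) auto
    also have "\<dots> \<le> 1" using N[of N n] by (auto simp: abs_le_iff)
    finally show ?thesis .
  qed
  then show ?thesis using l by blast
qed

text \<open>Only the histories consisting of right arrows are counted.\<close>
lemma mean_drift_small_gt_1: "1 < mean_drift (1 / 1000) 11"
proof -
  let ?l = "1 / 1000 :: real" and ?r = "\<lambda>m. replicate m True"
  interpret site_law "urn ?l" "4 / 5" by (rule site_law_urn) simp
  \<comment> \<open>With this weight the proportion after any positive number of right arrows, and
    no left ones, is at least \<open>1999 / 2000\<close>.\<close>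
  have urn_r: "79 / 100 \<le> urn ?l (?r (Suc m))" for m
  proof -
    have "1999 / 2000 \<le> (1 / 2 * ?l + real (Suc m)) / (?l + real (Suc m))" by (simp add: field_simps)
    from reinf_mono[OF this] have "reinf (1999 / 2000) \<le> urn ?l (?r (Suc m))"
      unfolding urn_def count_list_replicate length_replicate .
    moreover have "79 / 100 \<le> reinf (1999 / 2000)" by (simp add: reinf_def power_divide)
    ultimately show ?thesis by linarith
  qed
  have wt_r: "1 / 2 * (79 / 100) ^ m \<le> wt (urn ?l) (?r (Suc m))" for m
  proof (induction m)
    case 0
    then show ?case using urn_ge[of ?l "[]"] by simp
  next
    case (Suc m)
    have "1 / 2 * (79 / 100) ^ m * (79 / 100) \<le> wt (urn ?l) (?r (Suc m)) * urn ?l (?r (Suc m))"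
      using Suc urn_r[of m] by (intro mult_mono) (auto simp: wt_nonneg G_nonneg G_le_1)
    then show ?case by (simp add: mult.commute)
  qed
  \<comment> \<open>\<open>58 / 100\<close> is \<open>2 * (79 / 100) - 1\<close>, a lower bound for
    the drift after right arrows only.\<close>
  have summand: "1 / 2 * (79 / 100) ^ m * (58 / 100) \<le> expect (urn ?l) (Suc m) (\<lambda>h. 2 * urn ?l h - 1)" for m
  proof -
    have "1 / 2 * (79 / 100) ^ m * (58 / 100) \<le> wt (urn ?l) (?r (Suc m)) * (2 * urn ?l (?r (Suc m)) - 1)"
      using wt_r[of m] urn_r[of m] by (intro mult_mono) (auto simp: wt_nonneg G_nonneg G_le_1 simp del: replicate.simps)
    also have "\<dots> \<le> expect (urn ?l) (Suc m) (\<lambda>h. 2 * urn ?l h - 1)"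
      unfolding expect_def
    proof (rule member_le_sum)
      fix h
      have "0 \<le> 2 * urn ?l h - 1" using urn_ge[of ?l h] by linarith
      then show "0 \<le> wt (urn ?l) h * (2 * urn ?l h - 1)"
        by (intro mult_nonneg_nonneg wt_nonneg G_nonneg G_le_1)
    qed auto
    finally show ?thesis .
  qed
  have "1 < (\<Sum>m<10. 1 / 2 * (79 / 100 :: real) ^ m * (58 / 100))"
    by (simp add: numeral_eq_Suc)
  also have "\<dots> \<le> (\<Sum>m<10. expect (urn ?l) (Suc m) (\<lambda>h. 2 * urn ?l h - 1))" by (intro sum_mono summand)
  also have "\<dots> \<le> expect (urn ?l) 0 (\<lambda>h. 2 * urn ?l h - 1) + (\<Sum>m<10. expect (urn ?l) (Suc m) (\<lambda>h. 2 * urn ?l h - 1))"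
    using urn_ge[of ?l "[]"] by simp
  also have "\<dots> = (\<Sum>m<Suc 10. expect (urn ?l) m (\<lambda>h. 2 * urn ?l h - 1))"
    by (rule sum.lessThan_Suc_shift[symmetric])
  also have "\<dots> = mean_drift ?l 11" unfolding mean_drift_eq_sum by simp
  finally show ?thesis .
qed

text \<open>Each condition \<open>mean_drift l n \<le> 1\<close> is closed by continuity, so the
  infimum of the admissible weights is attained, and antitonicity makes every larger weight
  admissible.\<close>

lemma critical_length: "\<exists>l1>0. \<forall>l>0. (\<forall>n. mean_drift l n \<le> 1) \<longleftrightarrow> l1 \<le> l"
proof -
  define A where "A = (\<Inter>n. {l\<in>{1 / 1000..}. mean_drift l n \<le> 1})"
  have lower: "1 / 1000 \<le> l" if "0 < l" "\<forall>n. mean_drift l n \<le> 1" for l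
  proof (rule ccontr)
    assume "\<not> 1 / 1000 \<le> l"
    then have "mean_drift (1 / 1000) 11 \<le> mean_drift l 11" using that by (intro mean_drift_antimono) auto
    then show False using mean_drift_small_gt_1 that(2)[rule_format, of 11] by linarith
  qed
  have "closed A"
    unfolding A_def
  proof (intro closed_INT ballI continuous_on_closed_Collect_le)
    show "continuous_on {1 / 1000..} (\<lambda>l. mean_drift l n)" for n
      by (rule continuous_on_subset[OF continuous_on_mean_drift]) auto
  qed auto
  moreover obtain l0 where "0 < l0" "\<forall>n. mean_drift l0 n \<le> 1" using mean_drift_le_1_eventually by blast
  then have ne: "A \<noteq> {}" using lower[of l0] by (auto simp: A_def)
  moreover have bdd: "bdd_below A" unfolding A_def by (rule bdd_belowI[of _ "1 / 1000"]) auto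
  ultimately have mem: "Inf A \<in> A" by (intro closed_contains_Inf)
  then have pos: "1 / 1000 \<le> Inf A" by (auto simp: A_def)
  show ?thesis
  proof (intro exI[of _ "Inf A"] conjI allI impI iffI)
    show "0 < Inf A" using pos by linarith
    show "Inf A \<le> l" if "0 < l" "\<forall>n. mean_drift l n \<le> 1" for l
      using that lower[OF that] bdd by (intro cInf_lower) (auto simp: A_def)
    show "mean_drift l n \<le> 1" if "Inf A \<le> l" for l n
    proof -
      have "mean_drift l n \<le> mean_drift (Inf A) n" using that pos by (intro mean_drift_antimono) auto
      also have "\<dots> \<le> 1" using mem by (auto simp: A_def)
      finally show ?thesis .
    qed
  qed
qed

theorem theorem3:
  "\<exists>f :: real \<Rightarrow> real.
     C3_on_unit f \<and> (\<forall>x\<in>{0..1}. 0 < f x \<and> f x < 1) \<and>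
     isolated_fixed_points f \<and> (\<forall>x\<in>{0..1}. f x \<ge> 1/2) \<and>
     stable_fixed_point f (1/2) \<and> (\<forall>p. stable_fixed_point f p \<longrightarrow> p = 1/2) \<and>
     (\<exists>l1 > 0. \<forall>l > (0::real).
        (l \<ge> l1 \<longrightarrow> (AE \<omega> in unif_seq. recurrent (grrw f (\<lambda>_. 1/2) (\<lambda>_. l) \<omega>))) \<and>
        (l < l1 \<longrightarrow> (AE \<omega> in unif_seq. transient (grrw f (\<lambda>_. 1/2) (\<lambda>_. l) \<omega>))))"
proof (intro exI[of _ reinf] conjI)
  show "C3_on_unit reinf" by (rule C3_reinf)
  show "\<forall>x\<in>{0..1}. 0 < reinf x \<and> reinf x < 1"
  proof
    fix x :: real assume "x \<in> {0..1}"
    then show "0 < reinf x \<and> reinf x < 1" using reinf_ge[of x] reinf_le[of x] by auto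
  qed
  show "isolated_fixed_points reinf"
    unfolding isolated_fixed_points_def reinf_fixed_point by (auto intro: exI[of _ 1])
  show "\<forall>x\<in>{0..1}. reinf x \<ge> 1/2" using reinf_ge by blast
  have "deriv reinf (1/2) = 0" using DERIV_imp_deriv[OF reinf_deriv[of "1/2"]] by simp
  then show "stable_fixed_point reinf (1/2)" by (simp add: stable_fixed_point_def reinf_fixed_point)
  show "\<forall>p. stable_fixed_point reinf p \<longrightarrow> p = 1/2" by (simp add: stable_fixed_point_def reinf_fixed_point)
  obtain l1 where l1: "0 < l1" "\<And>l. 0 < l \<Longrightarrow> (\<forall>n. mean_drift l n \<le> 1) \<longleftrightarrow> l1 \<le> l"
    using critical_length by blast
  show "\<exists>l1 > 0. \<forall>l > (0::real).
        (l \<ge> l1 \<longrightarrow> (AE \<omega> in unif_seq. recurrent (grrw reinf (\<lambda>_. 1/2) (\<lambda>_. l) \<omega>))) \<and>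
        (l < l1 \<longrightarrow> (AE \<omega> in unif_seq. transient (grrw reinf (\<lambda>_. 1/2) (\<lambda>_. l) \<omega>)))"
  proof (intro exI[of _ l1] conjI allI impI l1(1))
    fix l :: real assume l: "0 < l"
    interpret site_law "urn l" "4 / 5" by (rule site_law_urn[OF l])
    have walk: "grrw reinf (\<lambda>_. 1/2) (\<lambda>_. l) \<omega> = (\<lambda>n. pos (hist W \<omega> n))" for \<omega>
      by (rule ext) (rule grrw_eq)
    show "AE \<omega> in unif_seq. recurrent (grrw reinf (\<lambda>_. 1/2) (\<lambda>_. l) \<omega>)" if "l \<ge> l1"
      unfolding walk using that l1(2)[OF l] total_drift_le_1_iff[OF l]
      by (intro recurrent_if_total_drift_le_1) simp
    show "AE \<omega> in unif_seq. transient (grrw reinf (\<lambda>_. 1/2) (\<lambda>_. l) \<omega>)" if "l < l1"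
    proof -
      have "1 < total_drift" using that l1(2)[OF l] total_drift_le_1_iff[OF l] by auto
      from transient_if_total_drift_gt_1[OF this] show ?thesis
        unfolding walk transient_def by eventually_elim simp
    qed
  qed
qed

end
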